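(* LIHom is in XP parameterized by the vertex cover number of the guest graph $G$.
   Context: A homomorphism from a graph $G$ (guest) to a graph $H$ (host) is a map $\phi: V(G)\to V(H)$ with $\phi(u)\phi(v)\in E(H)$ for every $uv\in E(G)$; the guest graph has no self-loops, the host graph may have self-loops. $\phi$ is locally injective if for every $u\in V(G)$ the restriction of $\phi$ to $N_G(u)$ is injective. LIHom is the problem of deciding, given graphs $G$ and $H$ (both part of the input), whether there is a locally injective homomorphism from $G$ to $H$. The vertex cover number of $G$ is the minimum size of a set $S\subseteq V(G)$ such that $G\setminus S$ has no edges. *)

theory Defs
  imports "Graph_Theory.Graph_Theory"
begin

section \<open>Graphs\<close>

text \<open>
  An undirected graph is a symmetric set of arcs. Guests are finite, symmetric and loop-free
  (\<^locale>\<open>pair_graph\<close>), hosts are finite and symmetric (\<^locale>\<open>pair_pseudo_graph\<close>), so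
  they may have loops.
\<close>

definition graph_hom :: "('a \<Rightarrow> 'b) \<Rightarrow> 'a pair_pre_digraph \<Rightarrow> 'b pair_pre_digraph \<Rightarrow> bool" where
  "graph_hom \<phi> G H \<longleftrightarrow>
     \<phi> ` pverts G \<subseteq> pverts H \<and> (\<forall>(u, v) \<in> parcs G. (\<phi> u, \<phi> v) \<in> parcs H)"

definition neighborhood :: "'a pair_pre_digraph \<Rightarrow> 'a \<Rightarrow> 'a set" where
  "neighborhood G u = {v. (u, v) \<in> parcs G}"

definition locally_injective_hom ::
    "('a \<Rightarrow> 'b) \<Rightarrow> 'a pair_pre_digraph \<Rightarrow> 'b pair_pre_digraph \<Rightarrow> bool" where
  "locally_injective_hom \<phi> G H \<longleftrightarrow>
     graph_hom \<phi> G H \<and> (\<forall>u \<in> pverts G. inj_on \<phi> (neighborhood G u))"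

definition vertex_cover :: "'a pair_pre_digraph \<Rightarrow> 'a set \<Rightarrow> bool" where
  "vertex_cover G S \<longleftrightarrow>
     S \<subseteq> pverts G \<and> arcs (with_proj G \<restriction> (pverts G - S)) = {}"

definition vertex_cover_number :: "'a pair_pre_digraph \<Rightarrow> nat" where
  "vertex_cover_number G = (LEAST k. \<exists>S. vertex_cover G S \<and> card S = k)"


section \<open>Computation model\<close>

text \<open>
  The model is the language WHILE of N. D. Jones (Computability and Complexity from a
  Programming Perspective, 1997): structured programs over finitely many variables that
  hold binary trees, where every elementary operation has unit cost. Trees can only be
  built by pairing, taken apart, and tested for being a leaf; in particular there is no
  unit-cost test for equality of trees. With subtrees shared, each
  operation is a constant-size pointer manipulation, and WHILE programs and Turing machines
  simulate each other with polynomial overhead.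
\<close>

datatype data = Leaf | Node data data

fun data_size :: "data \<Rightarrow> nat" where
  "data_size Leaf = 1"
| "data_size (Node a b) = 1 + data_size a + data_size b"

fun left :: "data \<Rightarrow> data" where
  "left Leaf = Leaf"
| "left (Node a b) = a"

fun right :: "data \<Rightarrow> data" where
  "right Leaf = Leaf"
| "right (Node a b) = b"

datatype expr = ELeaf | EVar nat | ENode expr expr | ELeft expr | ERight expr

type_synonym state = "nat \<Rightarrow> data"

fun eval_expr :: "expr \<Rightarrow> state \<Rightarrow> data" where
  "eval_expr ELeaf s = Leaf"
| "eval_expr (EVar x) s = s x"
| "eval_expr (ENode a b) s = Node (eval_expr a s) (eval_expr b s)"
| "eval_expr (ELeft a) s = left (eval_expr a s)"
| "eval_expr (ERight a) s = right (eval_expr a s)"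

fun cost_expr :: "expr \<Rightarrow> nat" where
  "cost_expr ELeaf = 1"
| "cost_expr (EVar x) = 1"
| "cost_expr (ENode a b) = 1 + cost_expr a + cost_expr b"
| "cost_expr (ELeft a) = 1 + cost_expr a"
| "cost_expr (ERight a) = 1 + cost_expr a"

datatype com = Skip | Assign nat expr | Seq com com | If expr com com | While expr com

text \<open>
  \<open>exec c s t s'\<close>: started in state \<open>s\<close>, the program \<open>c\<close> halts after exactly \<open>t\<close>
  steps in state \<open>s'\<close>. A test succeeds if its value is not a leaf.
\<close>

inductive exec :: "com \<Rightarrow> state \<Rightarrow> nat \<Rightarrow> state \<Rightarrow> bool" where
  Skip: "exec Skip s 1 s"
| Assign: "exec (Assign x e) s (1 + cost_expr e) (s(x := eval_expr e s))"
| Seq: "exec c1 s1 t1 s2 \<Longrightarrow> exec c2 s2 t2 s3 \<Longrightarrow> exec (Seq c1 c2) s1 (t1 + t2) s3"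
| IfTrue: "eval_expr e s \<noteq> Leaf \<Longrightarrow> exec c1 s t s' \<Longrightarrow>
    exec (If e c1 c2) s (1 + cost_expr e + t) s'"
| IfFalse: "eval_expr e s = Leaf \<Longrightarrow> exec c2 s t s' \<Longrightarrow>
    exec (If e c1 c2) s (1 + cost_expr e + t) s'"
| WhileFalse: "eval_expr e s = Leaf \<Longrightarrow> exec (While e c) s (1 + cost_expr e) s"
| WhileTrue: "eval_expr e s1 \<noteq> Leaf \<Longrightarrow> exec c s1 t1 s2 \<Longrightarrow>
    exec (While e c) s2 t2 s3 \<Longrightarrow> exec (While e c) s1 (1 + cost_expr e + t1 + t2) s3"

inductive_cases exec_SkipE: "exec Skip s t s'"
inductive_cases exec_AssignE: "exec (Assign x e) s t s'"
inductive_cases exec_SeqE: "exec (Seq c1 c2) s t s'"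
inductive_cases exec_IfE: "exec (If e c1 c2) s t s'"
inductive_cases exec_WhileE: "exec (While e c) s t s'"

lemma exec_deterministic:
  "exec c s t s' \<Longrightarrow> exec c s t1 s1 \<Longrightarrow> t1 = t \<and> s1 = s'"
proof (induction arbitrary: t1 s1 rule: exec.induct)
  case (Skip s)
  then show ?case by (rule exec_SkipE) simp
next
  case (Assign x e s)
  then show ?case by (rule exec_AssignE) simp
next
  case (Seq c1 sa ta sb c2 tb sc)
  from Seq.prems obtain t t' s where *: "exec c1 sa t s" "exec c2 s t' s1" "t1 = t + t'"
    by (rule exec_SeqE)
  from Seq.IH(1)[OF *(1)] have "t = ta" "s = sb" by simp_all
  with Seq.IH(2)[of t' s1] * show ?case by simp
next
  case (IfTrue e s c1 t s' c2)
  from IfTrue.prems IfTrue.hyps obtain t' where *: "exec c1 s t' s1" "t1 = 1 + cost_expr e + t'"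
    by (elim exec_IfE) auto
  from IfTrue.IH[OF *(1)] *(2) show ?case by simp
next
  case (IfFalse e s c2 t s' c1)
  from IfFalse.prems IfFalse.hyps obtain t' where *: "exec c2 s t' s1" "t1 = 1 + cost_expr e + t'"
    by (elim exec_IfE) auto
  from IfFalse.IH[OF *(1)] *(2) show ?case by simp
next
  case (WhileFalse e s c)
  from WhileFalse.prems show ?case by (rule exec_WhileE) (use WhileFalse.hyps in simp_all)
next
  case (WhileTrue e sa c ta sb tb sc)
  from WhileTrue.prems obtain t t' s where
    *: "exec c sa t s" "exec (While e c) s t' s1" "t1 = 1 + cost_expr e + t + t'"
    by (rule exec_WhileE) (use WhileTrue.hyps in simp_all)
  from WhileTrue.IH(1)[OF *(1)] have "t = ta" "s = sb" by simp_all
  with WhileTrue.IH(2)[of t' s1] * show ?case by simp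
qed

text \<open>Input and output are passed in variable 0; all other variables start as leaves.\<close>

definition input :: "data \<Rightarrow> state" where
  "input d = (\<lambda>_. Leaf)(0 := d)"


section \<open>Parameterized problems and XP\<close>

fun encode_nat :: "nat \<Rightarrow> data" where
  "encode_nat 0 = Leaf"
| "encode_nat (Suc n) = Node Leaf (encode_nat n)"

definition computable :: "(nat \<Rightarrow> nat) \<Rightarrow> bool" where
  "computable f \<longleftrightarrow>
     (\<exists>c. \<forall>n. \<exists>t s. exec c (input (encode_nat n)) t s \<and> s 0 = encode_nat (f n))"

text \<open>
  A parameterized problem is a language \<open>L\<close> together with a parameterization \<open>\<kappa>\<close>. The
  algorithm receives only the instance, not the value of the parameter. It accepts if its
  output is not a leaf.
\<close>

definition in_XP :: "data set \<Rightarrow> (data \<Rightarrow> nat) \<Rightarrow> bool" where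
  "in_XP L \<kappa> \<longleftrightarrow>
     (\<exists>c f g. computable f \<and> computable g \<and>
        (\<forall>x. \<exists>t s. exec c (input x) t s \<and>
                   t \<le> f (\<kappa> x) * data_size x ^ g (\<kappa> x) \<and>
                   (s 0 \<noteq> Leaf \<longleftrightarrow> x \<in> L)))"


section \<open>The problem LIHom\<close>

text \<open>
  As inputs, graphs have vertex set \<open>{0, \<dots>, n - 1}\<close> and are given by their adjacency
  matrix, a list of \<open>n\<close> rows of \<open>n\<close> Boolean entries.
\<close>

fun encode_bool :: "bool \<Rightarrow> data" where
  "encode_bool False = Leaf"
| "encode_bool True = Node Leaf Leaf"

fun encode_list :: "data list \<Rightarrow> data" where
  "encode_list [] = Leaf"
| "encode_list (x # xs) = Node x (encode_list xs)"

definition encode_graph :: "nat pair_pre_digraph \<Rightarrow> data" where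
  "encode_graph G =
     (let n = card (pverts G) in
      encode_list (map (\<lambda>i. encode_list (map (\<lambda>j. encode_bool ((i, j) \<in> parcs G)) [0..<n])) [0..<n]))"

definition instances :: "(nat pair_pre_digraph \<times> nat pair_pre_digraph) set" where
  "instances = {(G, H). pair_graph G \<and> pair_pseudo_graph H \<and>
     (\<exists>n. pverts G = {..<n}) \<and> (\<exists>m. pverts H = {..<m})}"

fun encode_instance :: "nat pair_pre_digraph \<times> nat pair_pre_digraph \<Rightarrow> data" where
  "encode_instance (G, H) = Node (encode_graph G) (encode_graph H)"

definition LIHom :: "data set" where
  "LIHom = encode_instance ` {(G, H) \<in> instances. \<exists>\<phi>. locally_injective_hom \<phi> G H}"

text \<open>Trees that do not encode a pair of graphs have parameter 0 (and are not in \<^const>\<open>LIHom\<close>).\<close>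

definition guest_vertex_cover_number :: "data \<Rightarrow> nat" where
  "guest_vertex_cover_number x =
     (if x \<in> encode_instance ` instances
      then vertex_cover_number (fst (inv_into instances encode_instance x)) else 0)"

lemma encode_list_inject: "encode_list xs = encode_list ys \<longleftrightarrow> xs = ys"
proof (induction xs arbitrary: ys)
  case Nil
  then show ?case by (cases ys) auto
next
  case (Cons x xs)
  then show ?case by (cases ys) auto
qed

lemma encode_bool_inject: "encode_bool a = encode_bool b \<longleftrightarrow> a = b"
  by (cases a; cases b) auto

lemma encode_graph_inject:
  assumes G: "pair_wf_digraph G" "pverts G = {..<n}"
    and H: "pair_wf_digraph H" "pverts H = {..<m}"
    and eq: "encode_graph G = encode_graph H"
  shows "G = H"
proof -
  have rows: "map (\<lambda>i. encode_list (map (\<lambda>j. encode_bool ((i, j) \<in> parcs G)) [0..<n])) [0..<n]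
      = map (\<lambda>i. encode_list (map (\<lambda>j. encode_bool ((i, j) \<in> parcs H)) [0..<m])) [0..<m]"
    using eq by (simp add: encode_graph_def G(2) H(2) encode_list_inject)
  from arg_cong[OF this, of length] have nm: "n = m" by simp
  have "(i, j) \<in> parcs G \<longleftrightarrow> (i, j) \<in> parcs H" if "i < n" "j < n" for i j
    using rows that by (simp add: nm encode_list_inject encode_bool_inject)
  moreover have "i < n \<and> j < n" if "(i, j) \<in> parcs G \<or> (i, j) \<in> parcs H" for i j
    using that pair_wf_digraph.in_arcsD1[OF G(1)] pair_wf_digraph.in_arcsD2[OF G(1)]
      pair_wf_digraph.in_arcsD1[OF H(1)] pair_wf_digraph.in_arcsD2[OF H(1)] G(2) H(2) nm
    by blast
  ultimately have "parcs G = parcs H" by auto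
  with G(2) H(2) nm show ?thesis by simp
qed

lemma inj_on_encode_instance: "inj_on encode_instance instances"
proof (rule inj_onI, clarify)
  fix G H G' H'
  assume "(G, H) \<in> instances" "(G', H') \<in> instances"
    and "encode_instance (G, H) = encode_instance (G', H')"
  then show "G = G' \<and> H = H'"
    unfolding instances_def
    by (auto intro!: encode_graph_inject
        simp: pair_graph_def pair_digraph_def pair_pseudo_graph_def pair_fin_digraph_def)
qed

end

theory Submission
  imports Defs
begin

text \<open>
  A greedy maximal matching yields a vertex cover \<open>S\<close> of the guest with at most twice the
  optimal size \<open>k\<close>. For each of the at most \<open>m ^ (2 * k)\<close> maps of \<open>S\<close> into the host it remains to
  place the other vertices. They fall into at most \<open>4 ^ k\<close> classes of equal neighbourhoods;
  isolated vertices can go anywhere. All vertices of a class with non-empty neighbourhood must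
  have distinct images, so the vertices of class \<open>r\<close> occupy a set of hosts \<open>W r\<close> of known size, where
  \<open>W r\<close> and \<open>W q\<close> are disjoint whenever the neighbourhoods of \<open>r\<close> and \<open>q\<close> meet, and membership of a host
  in \<open>W r\<close> only depends on the map on \<open>S\<close>. Such families are found by dynamic programming over the
  hosts whose states are the vectors of cardinalities, of which there are at most
  \<open>(n + 1) ^ 4 ^ k\<close>.

  The algorithm is written in a functional language whose only loop is the fold over a list.
  A program runs in time polynomial in the length of the longest list that it folds
  over, with degree and coefficient depending on the program alone, so the time analysis reduces
  to bounding lengths of lists by \<open>data_size x ^ 4 ^ k\<close>.
\<close>

text \<open>The algorithm is not told \<open>k\<close> and must halt in time on every tree, so it
  computes a cover of its own; the factor 2 of the matching turns 2 ^ k possible neighbourhoods into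
  2 ^ (2 * k) = 4 ^ k. Placing the remaining vertices is not a bipartite matching problem: classes
  with disjoint neighbourhoods may share hosts, classes with intersecting ones may not. Apart from
  the cardinalities, however, every condition on the sets \<open>W r\<close> concerns one host at a
  time, so only the cardinalities have to be carried from one host to the next. They also suffice to
  rebuild a homomorphism, because vertices of one class are interchangeable. Counting list lengths
  instead of tree sizes is sound because pairing has unit cost: a huge tree with shared subtrees is
  built in few steps, and only walking along a list takes time. Numbers are unary lists, so
  comparing them is such a walk too. All powers that arise have base at most
  \<open>data_size x\<close> and exponent at most 4 ^ k. Trees that are no instances have parameter
  0 and leave only the exponent 4 ^ 0 = 1, so they must be rejected before the search.\<close>

section \<open>A fold language and its compilation\<close>

datatype tm = TEnv | TLeaf | TNode tm tm | TLeft tm | TRight tm | TIf tm tm tm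
  | TComp tm tm | TFold tm tm tm

text \<open>Every tree is a list along its right spine, so programs make sense on malformed input as
  well, and a unary number is simply a list of that length.\<close>

fun elems :: "data \<Rightarrow> data list" where
  "elems Leaf = []"
| "elems (Node a b) = a # elems b"

abbreviation len :: "data \<Rightarrow> nat" where
  "len d \<equiv> length (elems d)"

text \<open>
  In \<open>TFold l i b\<close> the body sees the current element, the accumulator and the enclosing
  environment as \<open>Node x (Node acc e)\<close>.
\<close>

primrec eval :: "tm \<Rightarrow> data \<Rightarrow> data" where
  "eval TEnv e = e"
| "eval TLeaf e = Leaf"
| "eval (TNode a b) e = Node (eval a e) (eval b e)"
| "eval (TLeft a) e = left (eval a e)"
| "eval (TRight a) e = right (eval a e)"
| "eval (TIf c a b) e = (if eval c e \<noteq> Leaf then eval a e else eval b e)"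
| "eval (TComp b a) e = eval b (eval a e)"
| "eval (TFold l i b) e =
     foldl (\<lambda>acc x. eval b (Node x (Node acc e))) (eval i e) (elems (eval l e))"

text \<open>\<open>bounded N t e\<close>: no list folded over during the evaluation is longer than \<open>N\<close>.\<close>

primrec bounded :: "nat \<Rightarrow> tm \<Rightarrow> data \<Rightarrow> bool" where
  "bounded N TEnv e = True"
| "bounded N TLeaf e = True"
| "bounded N (TNode a b) e = (bounded N a e \<and> bounded N b e)"
| "bounded N (TLeft a) e = bounded N a e"
| "bounded N (TRight a) e = bounded N a e"
| "bounded N (TIf c a b) e =
     (bounded N c e \<and> (if eval c e \<noteq> Leaf then bounded N a e else bounded N b e))"
| "bounded N (TComp b a) e = (bounded N a e \<and> bounded N b (eval a e))"
| "bounded N (TFold l i b) e =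
     (bounded N l e \<and> bounded N i e \<and> len (eval l e) \<le> N \<and>
      (\<forall>k < len (eval l e). bounded N b (Node (elems (eval l e) ! k)
         (Node (foldl (\<lambda>acc x. eval b (Node x (Node acc e))) (eval i e)
            (take k (elems (eval l e)))) e))))"

text \<open>
  Variable 0 receives the result, variable 1 holds the environment and variable 2 is a stack;
  the last two are restored on exit.
\<close>

abbreviation push :: com where
  "push \<equiv> Assign 2 (ENode (EVar 0) (EVar 2))"

abbreviation pop :: com where
  "pop \<equiv> Assign 2 (ERight (EVar 2))"

primrec compile :: "tm \<Rightarrow> com" where
  "compile TEnv = Assign 0 (EVar 1)"
| "compile TLeaf = Assign 0 ELeaf"
| "compile (TNode a b) =
     Seq (compile a) (Seq push (Seq (compile b)
       (Seq (Assign 0 (ENode (ELeft (EVar 2)) (EVar 0))) pop)))"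
| "compile (TLeft a) = Seq (compile a) (Assign 0 (ELeft (EVar 0)))"
| "compile (TRight a) = Seq (compile a) (Assign 0 (ERight (EVar 0)))"
| "compile (TIf c a b) = Seq (compile c) (If (EVar 0) (compile a) (compile b))"
| "compile (TComp b a) =
     Seq (compile a) (Seq (Assign 2 (ENode (EVar 1) (EVar 2))) (Seq (Assign 1 (EVar 0))
       (Seq (compile b) (Seq (Assign 1 (ELeft (EVar 2))) pop))))"
| "compile (TFold l i b) =
     Seq (compile l) (Seq push (Seq (compile i) (Seq
       (While (ELeft (EVar 2))
         (Seq (Assign 1 (ENode (ELeft (ELeft (EVar 2))) (ENode (EVar 0) (EVar 1))))
         (Seq (Assign 2 (ENode (ERight (ELeft (EVar 2))) (ERight (EVar 2))))
         (Seq (compile b) (Assign 1 (ERight (ERight (EVar 1))))))))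
       pop)))"

section \<open>Execution within a time bound\<close>

definition exec_le :: "com \<Rightarrow> state \<Rightarrow> nat \<Rightarrow> state \<Rightarrow> bool" where
  "exec_le c s T s' \<longleftrightarrow> (\<exists>t\<le>T. exec c s t s')"

lemma exec_le_mono: "exec_le c s T s' \<Longrightarrow> T \<le> T' \<Longrightarrow> exec_le c s T' s'"
  unfolding exec_le_def by (meson order_trans)

lemma exec_le_Assign: "s' = s(x := eval_expr e s) \<Longrightarrow> exec_le (Assign x e) s (1 + cost_expr e) s'"
  unfolding exec_le_def using exec.Assign by blast

lemma exec_le_Seq:
  "exec_le c1 s T1 s1 \<Longrightarrow> exec_le c2 s1 T2 s2 \<Longrightarrow> exec_le (Seq c1 c2) s (T1 + T2) s2"
  unfolding exec_le_def by (meson add_mono exec.Seq)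

lemma exec_le_If:
  assumes "exec_le (if eval_expr e s \<noteq> Leaf then c1 else c2) s T s'"
  shows "exec_le (If e c1 c2) s (1 + cost_expr e + T) s'"
  using assms exec.IfTrue[of e s c1 _ s' c2] exec.IfFalse[of e s c2 _ s' c1]
  unfolding exec_le_def by (metis add_left_mono)

lemma exec_le_WhileFalse:
  "eval_expr e s = Leaf \<Longrightarrow> exec_le (While e c) s (1 + cost_expr e) s"
  unfolding exec_le_def using exec.WhileFalse by blast

lemma exec_le_WhileTrue:
  "eval_expr e s \<noteq> Leaf \<Longrightarrow> exec_le c s T1 s1 \<Longrightarrow> exec_le (While e c) s1 T2 s2 \<Longrightarrow>
    exec_le (While e c) s (1 + cost_expr e + T1 + T2) s2"
  unfolding exec_le_def by (meson add_mono order_refl exec.WhileTrue)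

text \<open>The rest of the list sits on top of the stack, the accumulator in variable 0. The body
  is only required to behave on the environments that the loop really meets, which is what
  \<open>bounded\<close> provides. One round costs 3 for the test and 8 + 7 + 4 for the assignments,
  which 25 covers; the final 3 is the failing test.\<close>

lemma exec_le_fold:
  assumes "\<And>k s. k < len L \<Longrightarrow> s 1 = Node (elems L ! k) (Node (foldl f a (take k (elems L))) e) \<Longrightarrow>
      exec_le c s T (s(0 := f (foldl f a (take k (elems L))) (elems L ! k)))"
    and "s 0 = a" "s 1 = e" "s 2 = Node L st"
  shows "exec_le (While (ELeft (EVar 2))
         (Seq (Assign 1 (ENode (ELeft (ELeft (EVar 2))) (ENode (EVar 0) (EVar 1))))
         (Seq (Assign 2 (ENode (ERight (ELeft (EVar 2))) (ERight (EVar 2))))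
         (Seq c (Assign 1 (ERight (ERight (EVar 1)))))))) s (len L * (T + 25) + 3)
         (s(0 := foldl f a (elems L), 2 := Node Leaf st))"
  using assms
proof (induction L arbitrary: s a)
  case Leaf
  then have eq: "s(0 := foldl f a (elems Leaf), 2 := Node Leaf st) = s" by auto
  have "eval_expr (ELeft (EVar 2)) s = Leaf" using Leaf by simp
  then show ?case
    unfolding eq by (rule exec_le_mono[OF exec_le_WhileFalse]) simp
next
  case (Node x L)
  define s1 where "s1 = s(1 := Node x (Node a e))"
  define s2 where "s2 = s1(2 := Node L st)"
  define s3 where "s3 = s2(0 := f a x)"
  define s4 where "s4 = s3(1 := e)"
  let ?b = "Seq (Assign 1 (ENode (ELeft (ELeft (EVar 2))) (ENode (EVar 0) (EVar 1))))
         (Seq (Assign 2 (ENode (ERight (ELeft (EVar 2))) (ERight (EVar 2))))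
         (Seq c (Assign 1 (ERight (ERight (EVar 1))))))"
  have "exec_le c s2 T s3"
  proof -
    have "s2 1 = Node x (Node a e)" by (simp add: s1_def s2_def)
    then show ?thesis using Node.prems(1)[of 0 s2] unfolding s3_def by (simp del: fun_upd_apply)
  qed
  moreover have "exec_le (Assign 1 (ENode (ELeft (ELeft (EVar 2))) (ENode (EVar 0) (EVar 1)))) s 8 s1"
    by (rule exec_le_mono[OF exec_le_Assign]) (use Node.prems in \<open>simp_all add: s1_def\<close>)
  moreover have "exec_le (Assign 2 (ENode (ERight (ELeft (EVar 2))) (ERight (EVar 2)))) s1 7 s2"
    by (rule exec_le_mono[OF exec_le_Assign]) (simp_all add: s1_def s2_def Node.prems)
  moreover have "exec_le (Assign 1 (ERight (ERight (EVar 1)))) s3 4 s4"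
    by (rule exec_le_mono[OF exec_le_Assign]) (simp_all add: s1_def s2_def s3_def s4_def Node.prems)
  ultimately have body: "exec_le ?b s (8 + (7 + (T + 4))) s4"
    by (intro exec_le_Seq)
  have IH: "exec_le (While (ELeft (EVar 2)) ?b) s4 (len L * (T + 25) + 3)
      (s4(0 := foldl f (f a x) (elems L), 2 := Node Leaf st))"
  proof (rule Node.IH)
    fix k and s :: state
    assume "k < len L" "s 1 = Node (elems L ! k) (Node (foldl f (f a x) (take k (elems L))) e)"
    then show "exec_le c s T (s(0 := f (foldl f (f a x) (take k (elems L))) (elems L ! k)))"
      using Node.prems(1)[of "Suc k" s] by (simp del: fun_upd_apply)
  qed (simp_all add: s1_def s2_def s3_def s4_def)
  have eq: "s4(0 := foldl f (f a x) (elems L), 2 := Node Leaf st)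
     = s(0 := foldl f a (elems (Node x L)), 2 := Node Leaf st)"
    using Node.prems by (auto simp: s1_def s2_def s3_def s4_def)
  have "eval_expr (ELeft (EVar 2)) s \<noteq> Leaf" using Node.prems by simp
  from exec_le_WhileTrue[OF this body IH] show ?case
    unfolding eq by (rule exec_le_mono) simp
qed

lemma poly_mono:
  fixes N :: nat
  assumes "1 \<le> N" "d \<le> D"
  shows "K * N ^ d \<le> K * N ^ D"
  using assms by (simp add: power_increasing)

lemma le_poly:
  fixes N :: nat
  assumes "1 \<le> N"
  shows "c \<le> c * N ^ D"
  using poly_mono[OF assms, of 0 D c] by simp

text \<open>\<open>K\<close> and \<open>D\<close> are chosen before \<open>N\<close> and the state.
  The final state differs from \<open>s\<close> in variable 0 only; this restoration of environment
  and stack lets the induction compose subprograms.\<close>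

theorem compile_correct:
  "\<exists>K D. \<forall>N\<ge>1. \<forall>s. bounded N t (s 1) \<longrightarrow> exec_le (compile t) s (K * N ^ D) (s(0 := eval t (s 1)))"
proof (induction t)
  case TEnv
  have "exec_le (compile TEnv) s 2 (s(0 := eval TEnv (s 1)))" for s
    unfolding compile.simps by (rule exec_le_mono[OF exec_le_Assign]) simp_all
  then show ?case
    by (rule_tac exI[of _ 2], rule_tac exI[of _ 0]) (simp del: fun_upd_apply)
next
  case TLeaf
  have "exec_le (compile TLeaf) s 2 (s(0 := eval TLeaf (s 1)))" for s
    unfolding compile.simps by (rule exec_le_mono[OF exec_le_Assign]) simp_all
  then show ?case
    by (rule_tac exI[of _ 2], rule_tac exI[of _ 0]) (simp del: fun_upd_apply)
next
  case (TNode a b)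
  then obtain K D K' D' where
    a: "\<And>N s. N \<ge> 1 \<Longrightarrow> bounded N a (s 1) \<Longrightarrow> exec_le (compile a) s (K * N ^ D) (s(0 := eval a (s 1)))"
    and b: "\<And>N s. N \<ge> 1 \<Longrightarrow> bounded N b (s 1) \<Longrightarrow> exec_le (compile b) s (K' * N ^ D') (s(0 := eval b (s 1)))"
    by blast
  show ?case
  proof (rule exI[of _ "K + K' + 12"], rule exI[of _ "D + D'"], intro allI impI)
    fix N :: nat and s :: state
    assume N: "1 \<le> N" and bd: "bounded N (TNode a b) (s 1)"
    define s1 where "s1 = s(0 := eval a (s 1))"
    define s2 where "s2 = s1(2 := Node (s1 0) (s1 2))"
    define s3 where "s3 = s2(0 := eval b (s2 1))"
    define s4 where "s4 = s3(0 := Node (eval a (s 1)) (s3 0))"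
    have A: "exec_le (compile (TNode a b)) s (K * N ^ D + (4 + (K' * N ^ D' + (5 + 3)))) (s4(2 := s 2))"
      unfolding compile.simps
    proof (intro exec_le_Seq)
      show "exec_le (compile a) s (K * N ^ D) s1" using bd a N by (simp add: s1_def)
      show "exec_le push s1 4 s2" by (rule exec_le_mono[OF exec_le_Assign]) (simp_all add: s2_def)
      have "s2 1 = s 1" by (simp add: s1_def s2_def)
      then show "exec_le (compile b) s2 (K' * N ^ D') s3" using bd b[of N s2] N by (simp add: s3_def)
      show "exec_le (Assign 0 (ENode (ELeft (EVar 2)) (EVar 0))) s3 5 s4"
        by (rule exec_le_mono[OF exec_le_Assign]) (simp_all add: s1_def s2_def s3_def s4_def)
      show "exec_le pop s4 3 (s4(2 := s 2))"
        by (rule exec_le_mono[OF exec_le_Assign]) (simp_all add: s1_def s2_def s3_def s4_def)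
    qed
    have E: "s4(2 := s 2) = s(0 := eval (TNode a b) (s 1))"
      by (auto simp: s1_def s2_def s3_def s4_def)
    have I: "K * N ^ D + (4 + (K' * N ^ D' + (5 + 3))) \<le> (K + K' + 12) * N ^ (D + D')"
      using poly_mono[OF N, of D "D + D'" K] poly_mono[OF N, of D' "D + D'" K']
        le_poly[OF N, of 12 "D + D'"]
      unfolding add_mult_distrib by linarith
    show "exec_le (compile (TNode a b)) s ((K + K' + 12) * N ^ (D + D')) (s(0 := eval (TNode a b) (s 1)))"
      using exec_le_mono[OF A I] unfolding E .
  qed
next
  case (TLeft a)
  then obtain K D where
    a: "\<And>N s. N \<ge> 1 \<Longrightarrow> bounded N a (s 1) \<Longrightarrow> exec_le (compile a) s (K * N ^ D) (s(0 := eval a (s 1)))"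
    by blast
  show ?case
  proof (rule exI[of _ "K + 3"], rule exI[of _ D], intro allI impI)
    fix N :: nat and s :: state
    assume N: "1 \<le> N" and bd: "bounded N (TLeft a) (s 1)"
    have "exec_le (compile (TLeft a)) s (K * N ^ D + 3) (s(0 := eval (TLeft a) (s 1)))"
      unfolding compile.simps using bd N
      by (intro exec_le_Seq[OF a exec_le_mono[OF exec_le_Assign]]) auto
    then show "exec_le (compile (TLeft a)) s ((K + 3) * N ^ D) (s(0 := eval (TLeft a) (s 1)))"
      by (rule exec_le_mono) (use N in \<open>simp add: algebra_simps\<close>)
  qed
next
  case (TRight a)
  then obtain K D where
    a: "\<And>N s. N \<ge> 1 \<Longrightarrow> bounded N a (s 1) \<Longrightarrow> exec_le (compile a) s (K * N ^ D) (s(0 := eval a (s 1)))"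
    by blast
  show ?case
  proof (rule exI[of _ "K + 3"], rule exI[of _ D], intro allI impI)
    fix N :: nat and s :: state
    assume N: "1 \<le> N" and bd: "bounded N (TRight a) (s 1)"
    have "exec_le (compile (TRight a)) s (K * N ^ D + 3) (s(0 := eval (TRight a) (s 1)))"
      unfolding compile.simps using bd N
      by (intro exec_le_Seq[OF a exec_le_mono[OF exec_le_Assign]]) auto
    then show "exec_le (compile (TRight a)) s ((K + 3) * N ^ D) (s(0 := eval (TRight a) (s 1)))"
      by (rule exec_le_mono) (use N in \<open>simp add: algebra_simps\<close>)
  qed
next
  case (TIf c a b)
  then obtain K D K' D' K'' D'' where
    c: "\<And>N s. N \<ge> 1 \<Longrightarrow> bounded N c (s 1) \<Longrightarrow> exec_le (compile c) s (K * N ^ D) (s(0 := eval c (s 1)))"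
    and a: "\<And>N s. N \<ge> 1 \<Longrightarrow> bounded N a (s 1) \<Longrightarrow> exec_le (compile a) s (K' * N ^ D') (s(0 := eval a (s 1)))"
    and b: "\<And>N s. N \<ge> 1 \<Longrightarrow> bounded N b (s 1) \<Longrightarrow> exec_le (compile b) s (K'' * N ^ D'') (s(0 := eval b (s 1)))"
    by blast
  show ?case
  proof (rule exI[of _ "K + K' + K'' + 2"], rule exI[of _ "D + (D' + D'')"], intro allI impI)
    fix N :: nat and s :: state
    assume N: "1 \<le> N" and bd: "bounded N (TIf c a b) (s 1)"
    define s1 where "s1 = s(0 := eval c (s 1))"
    have A: "exec_le (compile (TIf c a b)) s (K * N ^ D + (2 + (K' * N ^ D' + K'' * N ^ D'')))
       (s(0 := eval (TIf c a b) (s 1)))"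
      unfolding compile.simps
    proof (rule exec_le_Seq)
      show "exec_le (compile c) s (K * N ^ D) s1" using bd c N by (simp add: s1_def)
      show "exec_le (If (EVar 0) (compile a) (compile b)) s1 (2 + (K' * N ^ D' + K'' * N ^ D''))
         (s(0 := eval (TIf c a b) (s 1)))"
      proof (rule exec_le_mono[OF exec_le_If])
        show "exec_le (if eval_expr (EVar 0) s1 \<noteq> Leaf then compile a else compile b) s1
          (K' * N ^ D' + K'' * N ^ D'') (s(0 := eval (TIf c a b) (s 1)))"
          using bd N exec_le_mono[OF a[of N s1]] exec_le_mono[OF b[of N s1]]
          by (auto simp: s1_def)
      qed simp
    qed
    have I: "K * N ^ D + (2 + (K' * N ^ D' + K'' * N ^ D'')) \<le>
      (K + K' + K'' + 2) * N ^ (D + (D' + D''))"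
      using poly_mono[OF N, of D "D + (D' + D'')" K] poly_mono[OF N, of D' "D + (D' + D'')" K']
        poly_mono[OF N, of D'' "D + (D' + D'')" K''] le_poly[OF N, of 2 "D + (D' + D'')"]
      unfolding add_mult_distrib by linarith
    show "exec_le (compile (TIf c a b)) s ((K + K' + K'' + 2) * N ^ (D + (D' + D'')))
       (s(0 := eval (TIf c a b) (s 1)))"
      by (rule exec_le_mono[OF A I])
  qed
next
  case (TComp b a)
  then obtain K D K' D' where
    a: "\<And>N s. N \<ge> 1 \<Longrightarrow> bounded N a (s 1) \<Longrightarrow> exec_le (compile a) s (K * N ^ D) (s(0 := eval a (s 1)))"
    and b: "\<And>N s. N \<ge> 1 \<Longrightarrow> bounded N b (s 1) \<Longrightarrow> exec_le (compile b) s (K' * N ^ D') (s(0 := eval b (s 1)))"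
    by blast
  show ?case
  proof (rule exI[of _ "K + K' + 12"], rule exI[of _ "D + D'"], intro allI impI)
    fix N :: nat and s :: state
    assume N: "1 \<le> N" and bd: "bounded N (TComp b a) (s 1)"
    define s1 where "s1 = s(0 := eval a (s 1))"
    define s2 where "s2 = s1(2 := Node (s 1) (s 2))"
    define s3 where "s3 = s2(1 := s1 0)"
    define s4 where "s4 = s3(0 := eval b (s3 1))"
    define s5 where "s5 = s4(1 := s 1)"
    have A: "exec_le (compile (TComp b a)) s (K * N ^ D + (4 + (2 + (K' * N ^ D' + (3 + 3))))) (s5(2 := s 2))"
      unfolding compile.simps
    proof (intro exec_le_Seq)
      show "exec_le (compile a) s (K * N ^ D) s1" using bd a N by (simp add: s1_def)
      show "exec_le (Assign 2 (ENode (EVar 1) (EVar 2))) s1 4 s2"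
        by (rule exec_le_mono[OF exec_le_Assign]) (simp_all add: s1_def s2_def)
      show "exec_le (Assign 1 (EVar 0)) s2 2 s3"
        by (rule exec_le_mono[OF exec_le_Assign]) (simp_all add: s2_def s3_def)
      have "s3 1 = eval a (s 1)" by (simp add: s1_def s2_def s3_def)
      then show "exec_le (compile b) s3 (K' * N ^ D') s4" using bd b[of N s3] N by (simp add: s4_def)
      show "exec_le (Assign 1 (ELeft (EVar 2))) s4 3 s5"
        by (rule exec_le_mono[OF exec_le_Assign]) (simp_all add: s1_def s2_def s3_def s4_def s5_def)
      show "exec_le pop s5 3 (s5(2 := s 2))"
        by (rule exec_le_mono[OF exec_le_Assign]) (simp_all add: s1_def s2_def s3_def s4_def s5_def)
    qed
    have E: "s5(2 := s 2) = s(0 := eval (TComp b a) (s 1))"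
      by (auto simp: s1_def s2_def s3_def s4_def s5_def)
    have I: "K * N ^ D + (4 + (2 + (K' * N ^ D' + (3 + 3)))) \<le> (K + K' + 12) * N ^ (D + D')"
      using poly_mono[OF N, of D "D + D'" K] poly_mono[OF N, of D' "D + D'" K']
        le_poly[OF N, of 12 "D + D'"]
      unfolding add_mult_distrib by linarith
    show "exec_le (compile (TComp b a)) s ((K + K' + 12) * N ^ (D + D')) (s(0 := eval (TComp b a) (s 1)))"
      using exec_le_mono[OF A I] unfolding E .
  qed
next
  case (TFold l i b)
  then obtain K D K' D' K'' D'' where
    l: "\<And>N s. N \<ge> 1 \<Longrightarrow> bounded N l (s 1) \<Longrightarrow> exec_le (compile l) s (K * N ^ D) (s(0 := eval l (s 1)))"
    and i: "\<And>N s. N \<ge> 1 \<Longrightarrow> bounded N i (s 1) \<Longrightarrow> exec_le (compile i) s (K' * N ^ D') (s(0 := eval i (s 1)))"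
    and b: "\<And>N s. N \<ge> 1 \<Longrightarrow> bounded N b (s 1) \<Longrightarrow> exec_le (compile b) s (K'' * N ^ D'') (s(0 := eval b (s 1)))"
    by blast
  show ?case
  \<comment> \<open>Only a fold multiplies costs: the extra 1 in the exponent pays for up to
    \<open>N\<close> rounds. The constant is 25 per round plus 4 + 3 + 3 around the loop.\<close>
  proof (rule exI[of _ "K + K' + K'' + 35"], rule exI[of _ "D + (D' + (D'' + 1))"], intro allI impI)
    fix N :: nat and s :: state
    assume N: "1 \<le> N" and bd: "bounded N (TFold l i b) (s 1)"
    let ?L = "eval l (s 1)" and ?a = "eval i (s 1)"
    let ?f = "\<lambda>acc x. eval b (Node x (Node acc (s 1)))"
    define s1 where "s1 = s(0 := ?L)"
    define s2 where "s2 = s1(2 := Node ?L (s 2))"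
    define s3 where "s3 = s2(0 := eval i (s2 1))"
    define s4 where "s4 = s3(0 := foldl ?f ?a (elems ?L), 2 := Node Leaf (s 2))"
    have A: "exec_le (compile (TFold l i b)) s
       (K * N ^ D + (4 + (K' * N ^ D' + ((len ?L * (K'' * N ^ D'' + 25) + 3) + 3)))) (s4(2 := s 2))"
      unfolding compile.simps
    proof (intro exec_le_Seq)
      show "exec_le (compile l) s (K * N ^ D) s1" using bd l N by (simp add: s1_def)
      show "exec_le push s1 4 s2"
        by (rule exec_le_mono[OF exec_le_Assign]) (simp_all add: s1_def s2_def)
      have "s2 1 = s 1" by (simp add: s1_def s2_def)
      then show "exec_le (compile i) s2 (K' * N ^ D') s3" using bd i[of N s2] N by (simp add: s3_def)
      show "exec_le (While (ELeft (EVar 2))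
         (Seq (Assign 1 (ENode (ELeft (ELeft (EVar 2))) (ENode (EVar 0) (EVar 1))))
         (Seq (Assign 2 (ENode (ERight (ELeft (EVar 2))) (ERight (EVar 2))))
         (Seq (compile b) (Assign 1 (ERight (ERight (EVar 1)))))))) s3
         (len ?L * (K'' * N ^ D'' + 25) + 3) s4"
        unfolding s4_def
      proof (rule exec_le_fold[where e = "s 1"])
        fix k and s' :: state
        assume "k < len ?L" and s': "s' 1 = Node (elems ?L ! k) (Node (foldl ?f ?a (take k (elems ?L))) (s 1))"
        then have "bounded N b (s' 1)" using bd by simp
        from b[of N s', OF N this] show "exec_le (compile b) s' (K'' * N ^ D'')
          (s'(0 := ?f (foldl ?f ?a (take k (elems ?L))) (elems ?L ! k)))"
          unfolding s' .
      qed (simp_all add: s1_def s2_def s3_def)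
      show "exec_le pop s4 3 (s4(2 := s 2))"
        by (rule exec_le_mono[OF exec_le_Assign]) (simp_all add: s4_def)
    qed
    have E: "s4(2 := s 2) = s(0 := eval (TFold l i b) (s 1))"
      by (auto simp: s1_def s2_def s3_def s4_def)
    have I: "K * N ^ D + (4 + (K' * N ^ D' + ((len ?L * (K'' * N ^ D'' + 25) + 3) + 3)))
      \<le> (K + K' + K'' + 35) * N ^ (D + (D' + (D'' + 1)))"
    proof -
      have "len ?L \<le> N" using bd by simp
      then have "len ?L * (K'' * N ^ D'' + 25) \<le> N * (K'' * N ^ D'' + 25)" by (rule mult_le_mono1)
      also have "\<dots> = K'' * N ^ (D'' + 1) + 25 * N ^ 1" by (simp add: algebra_simps)
      finally show ?thesis
        using poly_mono[OF N, of D "D + (D' + (D'' + 1))" K]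
          poly_mono[OF N, of D' "D + (D' + (D'' + 1))" K']
          poly_mono[OF N, of "D'' + 1" "D + (D' + (D'' + 1))" K'']
          poly_mono[OF N, of 1 "D + (D' + (D'' + 1))" 25]
          le_poly[OF N, of 10 "D + (D' + (D'' + 1))"]
        unfolding add_mult_distrib by linarith
    qed
    show "exec_le (compile (TFold l i b)) s ((K + K' + K'' + 35) * N ^ (D + (D' + (D'' + 1))))
       (s(0 := eval (TFold l i b) (s 1)))"
      using exec_le_mono[OF A I] unfolding E .
  qed
qed

section \<open>The algorithm\<close>

lemma elems_encode_list [simp]: "elems (encode_list xs) = xs"
  by (induction xs) auto

lemma encode_list_elems [simp]: "encode_list (elems d) = d"
  by (induction d) auto

lemma elems_eq_Nil [simp]: "elems d = [] \<longleftrightarrow> d = Leaf"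
  by (cases d) auto

lemma len_encode_nat [simp]: "len (encode_nat n) = n"
  by (induction n) auto

lemma elems_right: "elems ((right ^^ k) d) = drop k (elems d)"
proof (induction k arbitrary: d)
  case (Suc k)
  then show ?case by (cases d) (simp_all add: funpow_swap1)
qed simp

definition nthd :: "nat \<Rightarrow> data \<Rightarrow> data" where
  "nthd k d = left ((right ^^ k) d)"

lemma nthd_0 [simp]: "nthd 0 d = left d"
  by (simp add: nthd_def)

lemma nthd_Suc [simp]: "nthd (Suc k) (Node a b) = nthd k b"
  by (simp add: nthd_def funpow_swap1)

lemma nthd_numeral [simp]: "nthd (numeral k) (Node a b) = nthd (pred_numeral k) b"
  by (simp add: numeral_eq_Suc)

lemma nthd_elems: "nthd k d = (if k < len d then elems d ! k else Leaf)"
proof (induction k arbitrary: d)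
  case 0
  show ?case by (cases d) auto
next
  case (Suc k)
  show ?case
  proof (cases d)
    case Leaf
    have "(right ^^ k) Leaf = Leaf" by (induction k) auto
    then show ?thesis using Leaf by (simp add: nthd_def)
  qed (simp add: Suc)
qed

text \<open>Reading past the end of a list yields \<open>Leaf\<close>, so this is a total relation
  that is false outside the stored rows.\<close>

definition edge :: "data \<Rightarrow> nat \<Rightarrow> nat \<Rightarrow> bool" where
  "edge M i j \<longleftrightarrow> nthd j (nthd i M) \<noteq> Leaf"

definition holds :: "tm \<Rightarrow> data \<Rightarrow> bool" where
  "holds t e \<longleftrightarrow> eval t e \<noteq> Leaf"

text \<open>Environments are lists, and each binder adds its variable at the front (de Bruijn indices).\<close>

definition var :: "nat \<Rightarrow> tm" where
  "var k = TLeft ((TRight ^^ k) TEnv)"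

definition not_t :: "tm \<Rightarrow> tm" where
  "not_t a = TIf a TLeaf (TNode TLeaf TLeaf)"

definition and_t :: "tm \<Rightarrow> tm \<Rightarrow> tm" where
  "and_t a b = TIf a b TLeaf"

definition or_t :: "tm \<Rightarrow> tm \<Rightarrow> tm" where
  "or_t a b = TIf a (TNode TLeaf TLeaf) b"

definition imp_t :: "tm \<Rightarrow> tm \<Rightarrow> tm" where
  "imp_t a b = TIf a b (TNode TLeaf TLeaf)"

definition iff_t :: "tm \<Rightarrow> tm \<Rightarrow> tm" where
  "iff_t a b = TIf a b (not_t b)"

text \<open>The condition \<open>b\<close> sees the element in front of the environment, without the accumulator.\<close>

definition filter_t :: "tm \<Rightarrow> tm \<Rightarrow> tm" where
  "filter_t l b = TFold l TLeaf
     (TIf (TComp b (TNode (var 0) (TRight (TRight TEnv)))) (TNode (var 0) (var 1)) (var 1))"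

definition all_t :: "tm \<Rightarrow> tm \<Rightarrow> tm" where
  "all_t l b = not_t (filter_t l (not_t b))"

text \<open>Truncated subtraction of the length of \<open>a\<close> from that of \<open>b\<close>.
  Lacking an equality test in the model, \<open>eq_t\<close> compares lengths by subtracting both
  ways.\<close>

definition drop_t :: "tm \<Rightarrow> tm \<Rightarrow> tm" where
  "drop_t a b = TFold a b (TRight (var 1))"

definition eq_t :: "tm \<Rightarrow> tm \<Rightarrow> tm" where
  "eq_t a b = and_t (not_t (drop_t a b)) (not_t (drop_t b a))"

definition nth_t :: "tm \<Rightarrow> tm \<Rightarrow> tm" where
  "nth_t m i = TLeft (drop_t i m)"

definition edge_t :: "tm \<Rightarrow> tm \<Rightarrow> tm \<Rightarrow> tm" where
  "edge_t m i j = nth_t (nth_t m i) j"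

text \<open>The head of the accumulator is the current count, so the result is n, n - 1, ..., 0 with
  one entry more than \<open>m\<close>. In full it lists the possible cardinalities; without its
  head (\<open>verts_t\<close>) it lists the vertices in descending order.\<close>

definition upto_t :: "tm \<Rightarrow> tm" where
  "upto_t m = TFold m (TNode TLeaf TLeaf) (TNode (TNode TLeaf (TLeft (var 1))) (var 1))"

definition list_t :: "tm list \<Rightarrow> tm" where
  "list_t ts = foldr TNode ts TLeaf"

lemma eval_var [simp]: "eval (var k) e = nthd k e"
proof -
  have "eval ((TRight ^^ k) TEnv) e = (right ^^ k) e" by (induction k) auto
  then show ?thesis by (simp add: var_def nthd_def)
qed

lemma bounded_var [simp]: "bounded N (var k) e"
proof -
  have "bounded N ((TRight ^^ k) TEnv) e" by (induction k) auto
  then show ?thesis by (simp add: var_def)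
qed

lemma eval_list_t [simp]: "eval (list_t []) e = Leaf"
    "eval (list_t (t # ts)) e = Node (eval t e) (eval (list_t ts) e)"
  by (simp_all add: list_t_def)

lemma bounded_list_t [simp]: "bounded N (list_t []) e"
    "bounded N (list_t (t # ts)) e \<longleftrightarrow> bounded N t e \<and> bounded N (list_t ts) e"
  by (simp_all add: list_t_def)

lemma holds_connectives [simp]:
  "holds (not_t a) e \<longleftrightarrow> \<not> holds a e"
  "holds (and_t a b) e \<longleftrightarrow> holds a e \<and> holds b e"
  "holds (or_t a b) e \<longleftrightarrow> holds a e \<or> holds b e"
  "holds (imp_t a b) e \<longleftrightarrow> (holds a e \<longrightarrow> holds b e)"
  "holds (iff_t a b) e \<longleftrightarrow> (holds a e \<longleftrightarrow> holds b e)"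
  "holds (TComp b a) e \<longleftrightarrow> holds b (eval a e)"
  by (auto simp: holds_def not_t_def and_t_def or_t_def imp_t_def iff_t_def)

lemma holds_accessors [simp]:
  "holds TEnv e \<longleftrightarrow> e \<noteq> Leaf"
  "holds (TLeft a) e \<longleftrightarrow> left (eval a e) \<noteq> Leaf"
  "holds (TRight a) e \<longleftrightarrow> right (eval a e) \<noteq> Leaf"
  "holds (var k) e \<longleftrightarrow> nthd k e \<noteq> Leaf"
  by (simp_all add: holds_def)

text \<open>Evaluation short-circuits: the second argument of a conjunction, disjunction or
  implication has to satisfy the bound only if it is reached.\<close>

lemma bounded_connectives [simp]:
  "bounded N (not_t a) e \<longleftrightarrow> bounded N a e"
  "bounded N (and_t a b) e \<longleftrightarrow> bounded N a e \<and> (holds a e \<longrightarrow> bounded N b e)"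
  "bounded N (or_t a b) e \<longleftrightarrow> bounded N a e \<and> (\<not> holds a e \<longrightarrow> bounded N b e)"
  "bounded N (imp_t a b) e \<longleftrightarrow> bounded N a e \<and> (holds a e \<longrightarrow> bounded N b e)"
  "bounded N (iff_t a b) e \<longleftrightarrow> bounded N a e \<and> bounded N b e"
  by (auto simp: holds_def not_t_def and_t_def or_t_def imp_t_def iff_t_def)

lemma eval_TIf: "eval (TIf c a b) e = (if holds c e then eval a e else eval b e)"
  by (simp add: holds_def)

lemma bounded_TIf:
  "bounded N (TIf c a b) e \<longleftrightarrow> bounded N c e \<and> (if holds c e then bounded N a e else bounded N b e)"
  by (simp add: holds_def)

lemma elems_filter_t [simp]:
  "elems (eval (filter_t l b) e) = rev (filter (\<lambda>x. holds b (Node x e)) (elems (eval l e)))"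
proof -
  have "elems (foldl (\<lambda>acc x. eval (TIf (TComp b (TNode (var 0) (TRight (TRight TEnv))))
      (TNode (var 0) (var 1)) (var 1)) (Node x (Node acc e))) a xs)
    = rev (filter (\<lambda>x. holds b (Node x e)) xs) @ elems a" for a xs
    by (induction xs arbitrary: a) (auto simp: holds_def)
  then show ?thesis by (simp add: filter_t_def)
qed

lemma ball_nth_conv: "(\<forall>k<length xs. P (xs ! k)) \<longleftrightarrow> (\<forall>x\<in>set xs. P x)"
  by (metis in_set_conv_nth)

lemma bounded_filter_t [simp]:
  "bounded N (filter_t l b) e \<longleftrightarrow>
     bounded N l e \<and> len (eval l e) \<le> N \<and> (\<forall>x\<in>set (elems (eval l e)). bounded N b (Node x e))"
  by (auto simp: filter_t_def ball_nth_conv[symmetric])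

lemma holds_filter_t [simp]:
  "holds (filter_t l b) e \<longleftrightarrow> (\<exists>x\<in>set (elems (eval l e)). holds b (Node x e))"
proof -
  have "holds (filter_t l b) e \<longleftrightarrow> elems (eval (filter_t l b) e) \<noteq> []"
    by (simp only: holds_def elems_eq_Nil)
  then show ?thesis by (auto simp: filter_empty_conv)
qed

lemma holds_all_t [simp]:
  "holds (all_t l b) e \<longleftrightarrow> (\<forall>x\<in>set (elems (eval l e)). holds b (Node x e))"
  by (simp add: all_t_def)

lemma bounded_all_t [simp]:
  "bounded N (all_t l b) e \<longleftrightarrow>
     bounded N l e \<and> len (eval l e) \<le> N \<and> (\<forall>x\<in>set (elems (eval l e)). bounded N b (Node x e))"
  by (simp add: all_t_def)

lemma eval_drop_t [simp]: "eval (drop_t a b) e = (right ^^ len (eval a e)) (eval b e)"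
proof -
  have "foldl (\<lambda>acc x. right acc) d xs = (right ^^ length xs) d" for d and xs :: "data list"
    by (induction xs arbitrary: d) (auto simp: funpow_swap1)
  then show ?thesis by (simp add: drop_t_def)
qed

lemma bounded_drop_t [simp]:
  "bounded N (drop_t a b) e \<longleftrightarrow> bounded N a e \<and> bounded N b e \<and> len (eval a e) \<le> N"
  by (auto simp: drop_t_def)

lemma holds_eq_t [simp]: "holds (eq_t a b) e \<longleftrightarrow> len (eval a e) = len (eval b e)"
proof -
  have "holds (drop_t a b) e \<longleftrightarrow> elems (eval (drop_t a b) e) \<noteq> []" for a b
    by (simp only: holds_def elems_eq_Nil)
  then show ?thesis by (auto simp: eq_t_def elems_right)
qed

text \<open>The second subtraction is reached only if the first leaves nothing, that is, if
  \<open>b\<close> is no longer than \<open>a\<close>; hence the conditional bound.\<close>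

lemma bounded_eq_t [simp]:
  "bounded N (eq_t a b) e \<longleftrightarrow>
     bounded N a e \<and> bounded N b e \<and> len (eval a e) \<le> N \<and> (len (eval b e) \<le> len (eval a e) \<longrightarrow> len (eval b e) \<le> N)"
proof -
  have "holds (drop_t a b) e \<longleftrightarrow> elems (eval (drop_t a b) e) \<noteq> []"
    by (simp only: holds_def elems_eq_Nil)
  then show ?thesis by (auto simp: eq_t_def elems_right)
qed

lemma holds_edge_t [simp]:
  "holds (edge_t m i j) e \<longleftrightarrow> edge (eval m e) (len (eval i e)) (len (eval j e))"
  by (simp add: edge_t_def nth_t_def edge_def nthd_def)

lemma bounded_edge_t [simp]:
  "bounded N (edge_t m i j) e \<longleftrightarrow> bounded N m e \<and> bounded N i e \<and> bounded N j e \<and>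
     len (eval i e) \<le> N \<and> len (eval j e) \<le> N"
  by (auto simp: edge_t_def nth_t_def)

definition codes :: "nat list \<Rightarrow> data" where
  "codes xs = encode_list (map encode_nat xs)"

lemma elems_codes [simp]: "elems (codes xs) = map encode_nat xs"
  by (simp add: codes_def)

lemma right_codes [simp]: "right (codes (x # xs)) = codes xs"
  by (simp add: codes_def)

lemma eval_upto_t [simp]:
  "eval (upto_t m) e = codes (len (eval m e) # rev [0..<len (eval m e)])"
proof -
  have "foldl (\<lambda>acc x. Node (Node Leaf (left acc)) acc) (Node Leaf Leaf) xs
      = codes (length xs # rev [0..<length xs])" for xs :: "data list"
    by (induction xs rule: rev_induct) (auto simp: codes_def)
  then show ?thesis by (simp add: upto_t_def)
qed

lemma bounded_upto_t [simp]: "bounded N (upto_t m) e \<longleftrightarrow> bounded N m e \<and> len (eval m e) \<le> N"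
  by (auto simp: upto_t_def)

abbreviation verts_t :: "tm \<Rightarrow> tm" where
  "verts_t m \<equiv> TRight (upto_t m)"

abbreviation "fst_t k \<equiv> TLeft (var k)"
abbreviation "snd_t k \<equiv> TRight (var k)"

text \<open>A function on vertices is represented as a list of pairs, in the order of its domain.\<close>

definition graph_of :: "nat list \<Rightarrow> (nat \<Rightarrow> nat) \<Rightarrow> data" where
  "graph_of xs f = encode_list (map (\<lambda>x. Node (encode_nat x) (encode_nat (f x))) xs)"

lemma elems_graph_of [simp]:
  "elems (graph_of xs f) = map (\<lambda>x. Node (encode_nat x) (encode_nat (f x))) xs"
  by (simp add: graph_of_def)

definition mat_t :: tm where
  "mat_t = all_t (var 0) (and_t (eq_t (var 1) (var 0))
     (all_t (var 0) (and_t (not_t (fst_t 0)) (not_t (snd_t 0)))))"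

definition sym_t :: tm where
  "sym_t = all_t (verts_t (var 0)) (all_t (verts_t (var 1))
     (imp_t (edge_t (var 2) (var 1) (var 0)) (edge_t (var 2) (var 0) (var 1))))"

definition loopfree_t :: tm where
  "loopfree_t = all_t (verts_t (var 0)) (not_t (edge_t (var 1) (var 0) (var 0)))"

text \<open>Environment \<open>[j, acc, i, acc', G]\<close>, where \<open>acc'\<close> is the
  accumulator with which row \<open>i\<close> was entered.\<close>

definition cover_step_t :: tm where
  "cover_step_t = TIf (and_t (edge_t (var 4) (var 2) (var 0))
       (not_t (filter_t (var 1) (or_t (eq_t (var 0) (var 3)) (eq_t (var 0) (var 1))))))
     (TNode (var 2) (TNode (var 0) (var 1))) (var 1)"

text \<open>A greedy maximal matching; its endpoints form a vertex cover.\<close>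

definition cover_t :: tm where
  "cover_t = TFold (verts_t (var 0)) TLeaf (TFold (verts_t (var 2)) (var 1) cover_step_t)"

text \<open>Environment \<open>[u, acc, S, G]\<close>.\<close>

definition reps_step_t :: tm where
  "reps_step_t = TIf (and_t (not_t (filter_t (var 2) (eq_t (var 0) (var 1))))
       (and_t (filter_t (var 2) (edge_t (var 4) (var 1) (var 0)))
         (not_t (filter_t (var 1) (all_t (var 3)
           (iff_t (edge_t (var 5) (var 2) (var 0)) (edge_t (var 5) (var 1) (var 0))))))))
     (TNode (var 0) (var 1)) (var 1)"

text \<open>
  Given a vertex cover and a graph: representatives of the classes of non-isolated vertices
  outside the cover with equal neighbourhoods.
\<close>

definition reps_t :: tm where
  "reps_t = TFold (verts_t (var 1)) TLeaf reps_step_t"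

text \<open>Environment \<open>[A, B]\<close>: all maps from \<open>A\<close> to \<open>B\<close>,
  obtained by extending every partial map by every value for the next argument. New arguments enter
  at the front, hence the \<open>rev\<close> in later statements.\<close>

definition funs_t :: tm where
  "funs_t = TFold (var 0) (TNode TLeaf TLeaf) (TFold (var 1) TLeaf (TFold (var 5) (var 1)
     (TNode (TNode (TNode (var 4) (var 0)) (var 2)) (var 1))))"

text \<open>
  The environments expected by the following terms are
  \<open>[w, r, \<phi>, G, H]\<close> for \<open>place_t\<close>, \<open>[r, q, \<phi>, G]\<close> for \<open>separated_t\<close> and
  \<open>[v, u, w, \<phi>, G, H]\<close> for \<open>step_t\<close>, which tests whether host \<open>w\<close> leads from the vector \<open>u\<close> to \<open>v\<close>.
  From \<open>reach_init_t\<close> to \<open>valid_t\<close> they end in \<open>[\<phi>, P, S, G, H]\<close>, where \<open>\<phi>\<close> maps the cover \<open>S\<close> into the host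
  and \<open>P\<close> are the representatives.
\<close>

definition place_t :: tm where
  "place_t = all_t (var 2) (imp_t (edge_t (var 4) (var 2) (fst_t 0))
     (and_t (edge_t (var 5) (var 1) (snd_t 0))
     (all_t (var 3)
       (and_t (imp_t (and_t (edge_t (var 5) (var 3) (fst_t 0)) (not_t (eq_t (fst_t 1) (fst_t 0))))
                (not_t (eq_t (snd_t 1) (snd_t 0))))
              (imp_t (edge_t (var 5) (fst_t 1) (fst_t 0)) (not_t (eq_t (snd_t 0) (var 2))))))))"

definition separated_t :: tm where
  "separated_t = all_t (var 2) (not_t (and_t (edge_t (var 4) (var 1) (fst_t 0)) (edge_t (var 4) (var 2) (fst_t 0))))"

definition step_t :: tm where
  "step_t = all_t (var 1) (all_t (var 1)
     (imp_t (and_t (eq_t (fst_t 1) (fst_t 0)) (not_t (eq_t (snd_t 1) (snd_t 0))))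
       (and_t (eq_t (snd_t 0) (TNode TLeaf (snd_t 1)))
       (and_t (TComp place_t (list_t [var 4, fst_t 1, var 5, var 6, var 7]))
         (all_t (var 3) (all_t (var 3)
           (imp_t (and_t (eq_t (fst_t 1) (fst_t 0))
               (and_t (not_t (eq_t (snd_t 1) (snd_t 0))) (not_t (eq_t (fst_t 3) (fst_t 1)))))
             (TComp separated_t (list_t [fst_t 3, fst_t 1, var 7, var 8])))))))))"

definition reach_init_t :: tm where
  "reach_init_t = filter_t (TComp funs_t (list_t [var 1, upto_t (var 3)])) (all_t (var 0) (not_t (snd_t 0)))"

definition reach_step_t :: tm where
  "reach_step_t = filter_t (TComp funs_t (list_t [var 3, upto_t (var 5)]))
     (filter_t (var 2) (TComp step_t (list_t [var 1, var 0, var 2, var 4, var 7, var 8])))"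

definition reach_t :: tm where
  "reach_t = TFold (verts_t (var 4)) reach_init_t reach_step_t"

definition count_t :: tm where
  "count_t = filter_t (verts_t (var 5))
     (and_t (not_t (filter_t (var 5) (eq_t (var 0) (var 1))))
       (all_t (var 5) (iff_t (edge_t (var 7) (var 1) (var 0)) (edge_t (var 7) (fst_t 2) (var 0)))))"

definition dp_t :: tm where
  "dp_t = filter_t reach_t (all_t (var 0) (eq_t (snd_t 0) count_t))"

definition valid_t :: tm where
  "valid_t = all_t (var 0) (all_t (var 1)
     (and_t (imp_t (edge_t (var 5) (fst_t 1) (fst_t 0)) (edge_t (var 6) (snd_t 1) (snd_t 0)))
       (all_t (var 2) (imp_t (and_t (edge_t (var 6) (fst_t 2) (fst_t 1))
            (and_t (edge_t (var 6) (fst_t 2) (fst_t 0)) (not_t (eq_t (fst_t 1) (fst_t 0)))))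
          (not_t (eq_t (snd_t 1) (snd_t 0)))))))"

definition search_t :: tm where
  "search_t = filter_t (TComp funs_t (list_t [var 1, verts_t (var 3)])) 
     (and_t valid_t dp_t)"

text \<open>The first conjunct is all that isolated vertices demand: a nonempty guest needs a
  nonempty host.\<close>

definition solve_t :: tm where
  "solve_t = and_t (or_t (not_t (var 0)) (var 1))
     (TComp (TComp search_t (TNode (TComp reps_t (list_t [var 0, var 1])) TEnv))
       (TNode cover_t TEnv))"

definition check_t :: tm where
  "check_t = and_t mat_t (and_t sym_t (and_t loopfree_t
     (TComp (and_t mat_t sym_t) (TRight TEnv))))"

text \<open>The order matters for the running time: short-circuiting keeps \<open>solve_t\<close>
  from running on trees that are no instances.\<close>

definition main_t :: tm where
  "main_t = and_t TEnv (TComp (and_t check_t solve_t) (list_t [TLeft TEnv, TRight TEnv]))"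

section \<open>Locally injective homomorphisms and host families\<close>

text \<open>\<open>W r\<close> stands for the image of class \<open>r\<close>, \<open>A w r\<close>
  says that host \<open>w\<close> suits the class, and \<open>D r q\<close> permits the two classes
  to share hosts.\<close>

definition family :: "(nat \<Rightarrow> nat \<Rightarrow> bool) \<Rightarrow> (nat \<Rightarrow> nat \<Rightarrow> bool) \<Rightarrow> nat set \<Rightarrow> nat set \<Rightarrow> (nat \<Rightarrow> nat) \<Rightarrow> bool" where
  "family A D P X h \<longleftrightarrow> (\<exists>W. \<forall>r\<in>P. W r \<subseteq> X \<and> card (W r) = h r \<and> (\<forall>w\<in>W r. A w r) \<and>
     (\<forall>q\<in>P. r \<noteq> q \<longrightarrow> W r \<inter> W q \<noteq> {} \<longrightarrow> D r q))"

text \<open>The transition of the dynamic program when host \<open>w\<close> is added: the classes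
  with \<open>g r \<noteq> h r\<close> are those that receive \<open>w\<close>.\<close>

definition family_step :: "(nat \<Rightarrow> nat \<Rightarrow> bool) \<Rightarrow> (nat \<Rightarrow> nat \<Rightarrow> bool) \<Rightarrow> nat set \<Rightarrow> nat \<Rightarrow> (nat \<Rightarrow> nat) \<Rightarrow> (nat \<Rightarrow> nat) \<Rightarrow> bool" where
  "family_step A D P w g h \<longleftrightarrow> (\<forall>r\<in>P. g r \<noteq> h r \<longrightarrow> h r = Suc (g r) \<and> A w r \<and>
     (\<forall>q\<in>P. g q \<noteq> h q \<longrightarrow> r \<noteq> q \<longrightarrow> D r q))"

lemma familyE:
  assumes "family A D P X h"
  obtains W where "\<And>r. r \<in> P \<Longrightarrow> W r \<subseteq> X" "\<And>r. r \<in> P \<Longrightarrow> card (W r) = h r"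
    "\<And>r v. r \<in> P \<Longrightarrow> v \<in> W r \<Longrightarrow> A v r"
    "\<And>r q. r \<in> P \<Longrightarrow> q \<in> P \<Longrightarrow> r \<noteq> q \<Longrightarrow> W r \<inter> W q \<noteq> {} \<Longrightarrow> D r q"
proof -
  obtain W where W: "\<forall>r\<in>P. W r \<subseteq> X \<and> card (W r) = h r \<and> (\<forall>w\<in>W r. A w r) \<and>
     (\<forall>q\<in>P. r \<noteq> q \<longrightarrow> W r \<inter> W q \<noteq> {} \<longrightarrow> D r q)"
    using assms unfolding family_def by (rule exE)
  show thesis by (rule that[of W]) (use W in blast)+
qed

lemma family_empty: "family A D P {} h \<longleftrightarrow> (\<forall>r\<in>P. h r = 0)"
  unfolding family_def by (auto intro!: exI[of _ "\<lambda>_. {}"])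

lemma family_step_le: "family_step A D P w g h \<Longrightarrow> r \<in> P \<Longrightarrow> g r \<le> h r"
  unfolding family_step_def by (metis le_SucI order_refl)

text \<open>Removing \<open>w\<close> from every \<open>W r\<close> or adding it where the vector
  grows translates between the two sides; the conditions at \<open>w\<close> depend only on which
  classes receive it.\<close>

lemma family_insert:
  assumes X: "finite X" "w \<notin> X"
  shows "family A D P (insert w X) h \<longleftrightarrow> (\<exists>g. family A D P X g \<and> family_step A D P w g h)"
proof
  assume "family A D P (insert w X) h"
  then obtain W where W: "\<And>r. r \<in> P \<Longrightarrow> W r \<subseteq> insert w X" "\<And>r. r \<in> P \<Longrightarrow> card (W r) = h r"
      "\<And>r v. r \<in> P \<Longrightarrow> v \<in> W r \<Longrightarrow> A v r"
      "\<And>r q. r \<in> P \<Longrightarrow> q \<in> P \<Longrightarrow> r \<noteq> q \<Longrightarrow> W r \<inter> W q \<noteq> {} \<Longrightarrow> D r q"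
    by (rule familyE) blast
  have fin: "finite (W r)" if "r \<in> P" for r
    using W(1)[OF that] X(1) finite_subset by blast
  define g where "g r = card (W r - {w})" for r
  have g: "h r = (if w \<in> W r then Suc (g r) else g r)" if "r \<in> P" for r
    using card.remove[OF fin[OF that], of w] W(2)[OF that] by (auto simp: g_def)
  have "family A D P X g"
    unfolding family_def
  proof (intro exI[of _ "\<lambda>r. W r - {w}"] ballI conjI impI)
    show "W r - {w} \<subseteq> X" if "r \<in> P" for r using W(1)[OF that] by auto
    show "D r q" if "r \<in> P" "q \<in> P" "r \<noteq> q" "(W r - {w}) \<inter> (W q - {w}) \<noteq> {}" for r q
      using W(4)[OF that(1-3)] that(4) by auto
  qed (use W(3) in \<open>auto simp: g_def\<close>)
  moreover have "family_step A D P w g h"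
    unfolding family_step_def using g W(3,4) by (metis IntI emptyE)
  ultimately show "\<exists>g. family A D P X g \<and> family_step A D P w g h" by blast
next
  assume "\<exists>g. family A D P X g \<and> family_step A D P w g h"
  then obtain g where st: "family_step A D P w g h" and "family A D P X g" by blast
  from this(2) obtain W where W: "\<And>r. r \<in> P \<Longrightarrow> W r \<subseteq> X" "\<And>r. r \<in> P \<Longrightarrow> card (W r) = g r"
      "\<And>r v. r \<in> P \<Longrightarrow> v \<in> W r \<Longrightarrow> A v r"
      "\<And>r q. r \<in> P \<Longrightarrow> q \<in> P \<Longrightarrow> r \<noteq> q \<Longrightarrow> W r \<inter> W q \<noteq> {} \<Longrightarrow> D r q"
    by (rule familyE) blast
  define W' where "W' r = (if g r = h r then W r else insert w (W r))" for r
  show "family A D P (insert w X) h"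
    unfolding family_def
  proof (intro exI[of _ W'] ballI conjI impI)
    fix r assume r: "r \<in> P"
    have "finite (W r)" "w \<notin> W r" using W(1)[OF r] X finite_subset by blast+
    then show "card (W' r) = h r"
      using W(2)[OF r] st r by (auto simp: W'_def family_step_def)
    show "W' r \<subseteq> insert w X" using W(1)[OF r] by (auto simp: W'_def)
    show "A v r" if "v \<in> W' r" for v
      using that W(3)[OF r] st r by (auto simp: W'_def family_step_def split: if_splits)
    show "D r q" if q: "q \<in> P" "r \<noteq> q" "W' r \<inter> W' q \<noteq> {}" for q
    \<comment> \<open>If the old sets are disjoint, the common host must be \<open>w\<close>, so
      both classes receive it.\<close>
    proof (cases "W r \<inter> W q = {}")
      case True
      moreover have "w \<notin> W r" "w \<notin> W q" using W(1) r q X by auto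
      ultimately have "g r \<noteq> h r" "g q \<noteq> h q"
        using q(3) by (auto simp: W'_def split: if_splits)
      then show ?thesis using st r q unfolding family_step_def by blast
    qed (use W(4) r q in blast)
  qed
qed

section \<open>Local injectivity in terms of a vertex cover\<close>

definition li_hom where
  "li_hom n m E F f \<longleftrightarrow> (\<forall>u<n. f u < m) \<and> (\<forall>u v. E u v \<longrightarrow> F (f u) (f v)) \<and> (\<forall>u<n. inj_on f {v. E u v})"
  for n m :: nat and E F :: "nat \<Rightarrow> nat \<Rightarrow> bool"

definition twins :: "nat \<Rightarrow> (nat \<Rightarrow> nat \<Rightarrow> bool) \<Rightarrow> nat set \<Rightarrow> nat \<Rightarrow> nat set" where
  "twins n E S r = {u. u < n \<and> u \<notin> S \<and> (\<forall>s\<in>S. E u s \<longleftrightarrow> E r s)}"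

definition valid where
  "valid E F S f \<longleftrightarrow> (\<forall>s\<in>S. \<forall>t\<in>S. (E s t \<longrightarrow> F (f s) (f t)) \<and>
     (\<forall>t'\<in>S. E s t \<and> E s t' \<and> t \<noteq> t' \<longrightarrow> f t \<noteq> f t'))"
  for E F :: "nat \<Rightarrow> nat \<Rightarrow> bool"

text \<open>All that putting a vertex of class \<open>r\<close> on \<open>w\<close> requires in
  relation to the cover: its edges are mapped to edges, its own neighbours have distinct images, and
  at each neighbour \<open>s\<close> it does not collide with the neighbours of \<open>s\<close> in
  the cover. Collisions between two vertices outside the cover are treated by
  \<open>separated\<close> and by distinctness within a class.\<close>

definition place where
  "place E F S f w r \<longleftrightarrow> (\<forall>s\<in>S. E r s \<longrightarrow> F w (f s) \<and>
     (\<forall>t\<in>S. (E r t \<and> s \<noteq> t \<longrightarrow> f s \<noteq> f t) \<and> (E s t \<longrightarrow> f t \<noteq> w)))"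
  for E F :: "nat \<Rightarrow> nat \<Rightarrow> bool"

text \<open>When \<open>S\<close> is a vertex cover, vertices outside have all their neighbours in
  \<open>S\<close>, so this is disjointness of neighbourhoods: no vertex then forbids the two to
  have equal images.\<close>

definition separated where
  "separated E S r q \<longleftrightarrow> (\<forall>s\<in>S. \<not> (E r s \<and> E q s))"
  for E :: "nat \<Rightarrow> nat \<Rightarrow> bool"

locale guest_host =
  fixes n m :: nat and E F :: "nat \<Rightarrow> nat \<Rightarrow> bool" and S P :: "nat set"
  assumes E_less: "E u v \<Longrightarrow> u < n" and E_sym: "E u v \<Longrightarrow> E v u" and E_irrefl: "\<not> E u u"
    and F_sym: "F w x \<Longrightarrow> F x w"
    and S_less: "s \<in> S \<Longrightarrow> s < n" and S_cover: "E u v \<Longrightarrow> u \<in> S \<or> v \<in> S"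
    and P_reps: "r \<in> P \<Longrightarrow> r < n \<and> r \<notin> S \<and> (\<exists>s\<in>S. E r s)"
    and P_ex: "u < n \<Longrightarrow> u \<notin> S \<Longrightarrow> s \<in> S \<Longrightarrow> E u s \<Longrightarrow> \<exists>r\<in>P. \<forall>s\<in>S. E u s \<longleftrightarrow> E r s"
    and P_unique: "r \<in> P \<Longrightarrow> q \<in> P \<Longrightarrow> (\<And>s. s \<in> S \<Longrightarrow> E r s \<longleftrightarrow> E q s) \<Longrightarrow> r = q"
begin

lemma li_hom_inj: "li_hom n m E F f \<Longrightarrow> E u v \<Longrightarrow> E u v' \<Longrightarrow> f v = f v' \<Longrightarrow> v = v'"
  unfolding li_hom_def inj_on_def using E_less by blast

text \<open>The images of the classes form the family. All members of a class share a neighbour in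
  the cover, so local injectivity there makes \<open>f\<close> injective on the class and preserves
  its cardinality.\<close>

lemma li_hom_family:
  assumes f: "li_hom n m E F f"
  shows "n = 0 \<or> m > 0" "\<And>s. s \<in> S \<Longrightarrow> f s < m" "valid E F S f"
    "family (place E F S f) (separated E S) P {..<m} (\<lambda>r. card (twins n E S r))"
proof -
  show "n = 0 \<or> m > 0" "\<And>s. s \<in> S \<Longrightarrow> f s < m"
    using f S_less unfolding li_hom_def by force+
  show "valid E F S f"
    unfolding valid_def using f li_hom_inj[OF f] by (auto simp: li_hom_def)
  show "family (place E F S f) (separated E S) P {..<m} (\<lambda>r. card (twins n E S r))"
    unfolding family_def
  proof (intro exI[of _ "\<lambda>r. f ` twins n E S r"] ballI conjI impI)
    fix r assume r: "r \<in> P"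
    then obtain s where s: "s \<in> S" "E r s" using P_reps by blast
    then have "\<And>u. u \<in> twins n E S r \<Longrightarrow> E s u" using E_sym by (auto simp: twins_def)
    then have "inj_on f (twins n E S r)" using li_hom_inj[OF f] unfolding inj_on_def by blast
    then show "card (f ` twins n E S r) = card (twins n E S r)" by (rule card_image)
    show "f ` twins n E S r \<subseteq> {..<m}" using f by (auto simp: twins_def li_hom_def)
    show "place E F S f w r" if "w \<in> f ` twins n E S r" for w
    proof -
      obtain u where u: "u \<in> twins n E S r" "w = f u" using \<open>w \<in> f ` twins n E S r\<close> by blast
      then have "\<And>s. s \<in> S \<Longrightarrow> E r s \<longleftrightarrow> E u s" "u \<notin> S" by (auto simp: twins_def)
      then show ?thesis
        unfolding place_def u using f li_hom_inj[OF f] E_sym unfolding li_hom_def by metis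
    qed
    show "separated E S r q" if q: "q \<in> P" "r \<noteq> q" "f ` twins n E S r \<inter> f ` twins n E S q \<noteq> {}" for q
    proof (rule ccontr)
      assume "\<not> separated E S r q"
      then obtain s where s: "s \<in> S" "E r s" "E q s" by (auto simp: separated_def)
      obtain u v where uv: "u \<in> twins n E S r" "v \<in> twins n E S q" "f u = f v" using q(3) by auto
      then have "E s u" "E s v" using s E_sym by (auto simp: twins_def)
      \<comment> \<open>Injectivity at the common neighbour \<open>s\<close> puts one vertex into
        both classes, so their representatives coincide.\<close>
      then have "u = v" using li_hom_inj[OF f] uv by blast
      then show False using P_unique[OF r q(1)] q(2) uv by (auto simp: twins_def)
    qed
  qed
qed

text \<open>Equal cardinalities give a bijection from each class onto its \<open>W r\<close>. Any
  bijection will do, since no condition distinguishes members of a class.\<close>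

lemma family_li_hom:
  assumes nm: "n = 0 \<or> m > 0" and less: "\<And>s. s \<in> S \<Longrightarrow> f s < m" and valid: "valid E F S f"
    and fam: "family (place E F S f) (separated E S) P {..<m} (\<lambda>r. card (twins n E S r))"
  shows "\<exists>f. li_hom n m E F f"
proof -
  from fam obtain W where W: "\<And>r. r \<in> P \<Longrightarrow> W r \<subseteq> {..<m}"
      "\<And>r. r \<in> P \<Longrightarrow> card (W r) = card (twins n E S r)"
      "\<And>r v. r \<in> P \<Longrightarrow> v \<in> W r \<Longrightarrow> place E F S f v r"
      "\<And>r q. r \<in> P \<Longrightarrow> q \<in> P \<Longrightarrow> r \<noteq> q \<Longrightarrow> W r \<inter> W q \<noteq> {} \<Longrightarrow> separated E S r q"
    by (rule familyE) blast
  have "\<exists>b. bij_betw b (twins n E S r) (W r)" if "r \<in> P" for r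
    using W(1,2)[OF that] by (intro finite_same_card_bij) (auto simp: twins_def intro: finite_subset)
  then obtain b where b: "\<And>r. r \<in> P \<Longrightarrow> bij_betw (b r) (twins n E S r) (W r)" by metis
  define rep where "rep u = (SOME r. r \<in> P \<and> (\<forall>s\<in>S. E u s \<longleftrightarrow> E r s))" for u
  have rep: "rep u \<in> P" "\<And>t. t \<in> S \<Longrightarrow> E u t \<longleftrightarrow> E (rep u) t" "u \<in> twins n E S (rep u)"
    "b (rep u) u \<in> W (rep u)" if u: "u \<notin> S" "s \<in> S" "E u s" for u s
  proof -
    have "\<exists>r. r \<in> P \<and> (\<forall>s\<in>S. E u s \<longleftrightarrow> E r s)" using P_ex u E_less by blast
    from someI_ex[OF this] show 1: "rep u \<in> P" "\<And>t. t \<in> S \<Longrightarrow> E u t \<longleftrightarrow> E (rep u) t"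
      unfolding rep_def by blast+
    then show "u \<in> twins n E S (rep u)" using u E_less by (auto simp: twins_def)
    then show "b (rep u) u \<in> W (rep u)" using b[OF 1(1)] by (auto simp: bij_betw_def)
  qed
  \<comment> \<open>Isolated vertices go to host 0, which exists by \<open>nm\<close> as soon as
    there is a guest vertex.\<close>
  define f' where "f' u = (if u \<in> S then f u else if \<exists>s\<in>S. E u s then b (rep u) u else 0)" for u
  have f'_S: "f' u = f u" if "u \<in> S" for u using that by (simp add: f'_def)
  have f'_rep: "f' u = b (rep u) u" if "u \<notin> S" "s \<in> S" "E u s" for u s
    using that by (auto simp: f'_def)
  have pl: "place E F S f (f' u) (rep u)" if "u \<notin> S" "s \<in> S" "E u s" for u s
    unfolding f'_rep[OF that] using W(3)[OF rep(1)[OF that] rep(4)[OF that]] .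
  \<comment> \<open>Edges starting in \<open>S\<close> suffice, as every edge has an endpoint in
    \<open>S\<close> and both relations are symmetric.\<close>
  have hom: "F (f' u) (f' v)" if "E u v" "u \<in> S" for u v
  proof (cases "v \<in> S")
    case True
    then show ?thesis using valid that f'_S by (simp add: valid_def)
  next
    case False
    have vu: "E v u" using that E_sym by blast
    then have "F (f' v) (f u)"
      using pl[OF False that(2) vu] rep(2)[OF False that(2) vu that(2)] that(2)
      by (auto simp: place_def)
    then show ?thesis using F_sym f'_S that by auto
  qed
  \<comment> \<open>For \<open>u\<close> in \<open>S\<close>, two neighbours in \<open>S\<close> are
    told apart by \<open>valid\<close>, a mixed pair by \<open>place\<close>, and two outside
    \<open>S\<close> by the bijection of their common class or, since \<open>u\<close> prevents
    separation, by disjointness of their sets \<open>W\<close>. For \<open>u\<close> outside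
    \<open>S\<close> both neighbours lie in \<open>S\<close> and \<open>place\<close> at the image
    of \<open>u\<close> applies.\<close>
  have inj: "f' v \<noteq> f' v'" if uv: "E u v" "E u v'" "v \<noteq> v'" for u v v'
  proof (cases "u \<in> S")
    case u: True
    have mixed: "f' v \<noteq> f' v'" if "E u v" "E u v'" "v \<notin> S" "v' \<in> S" for v v'
    proof -
      have vu: "E v u" using that E_sym by blast
      then have "f v' \<noteq> f' v"
        using pl[OF that(3) u vu] rep(2)[OF that(3) u vu u] u that unfolding place_def by blast
      then show ?thesis using f'_S that by simp
    qed
    show ?thesis
    proof (cases "v \<in> S"; cases "v' \<in> S")
      assume "v \<in> S" "v' \<in> S"
      then show ?thesis using valid u uv f'_S unfolding valid_def by metis
    next
      assume v: "v \<notin> S" "v' \<notin> S"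
      have vu: "E v u" "E v' u" using uv E_sym by blast+
      note r = rep[OF v(1) u vu(1)] rep[OF v(2) u vu(2)]
      show ?thesis
      proof (cases "rep v = rep v'")
        case True
        then show ?thesis
          using r b[OF r(1)] uv(3) f'_rep[OF v(1) u vu(1)] f'_rep[OF v(2) u vu(2)]
          by (auto simp: bij_betw_def inj_on_def)
      next
        case False
        have "\<not> separated E S (rep v) (rep v')" unfolding separated_def using r(2) r(6) u vu by blast
        then have "W (rep v) \<inter> W (rep v') = {}" using W(4)[OF r(1) r(5) False] by blast
        then show ?thesis
          using r(4) r(8) f'_rep[OF v(1) u vu(1)] f'_rep[OF v(2) u vu(2)] by auto
      qed
    qed (use mixed uv in metis)+
  next
    case u: False
    then have v: "v \<in> S" "v' \<in> S" using S_cover uv by blast+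
    have "E (rep u) v" "E (rep u) v'" using rep(2)[OF u v(1) uv(1)] v uv by auto
    then show ?thesis using pl[OF u v(1) uv(1)] v uv(3) f'_S unfolding place_def by metis
  qed
  have "li_hom n m E F f'"
    unfolding li_hom_def
  proof (intro conjI allI impI)
    show "f' u < m" if "u < n" for u
      using that nm less rep(1,4) W(1) by (fastforce simp: f'_def)
    show "F (f' u) (f' v)" if "E u v" for u v
      using hom[OF that] hom[of v u] E_sym[OF that] S_cover[OF that] F_sym by blast
    show "inj_on f' {v. E u v}" for u using inj by (auto simp: inj_on_def)
  qed
  then show ?thesis by blast
qed

theorem li_hom_iff:
  "(\<exists>f. li_hom n m E F f) \<longleftrightarrow> (n = 0 \<or> m > 0) \<and>
     (\<exists>f. (\<forall>s\<in>S. f s < m) \<and> valid E F S f \<and> family (place E F S f) (separated E S) P {..<m} (\<lambda>r. card (twins n E S r)))"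
  using li_hom_family family_li_hom by blast

end

section \<open>Evaluation of the subprograms\<close>

text \<open>Simulation: once a single step commutes with the encoding, the fold on trees mirrors the
  fold on the encoded objects.\<close>

lemma foldl_map_sim:
  assumes "\<And>acc x. f (c acc) (g x) = c (h acc x)"
  shows "foldl f (c a) (map g xs) = c (foldl h a xs)"
  using assms by (induction xs arbitrary: a) simp_all

definition extend :: "data \<Rightarrow> data \<Rightarrow> data \<Rightarrow> data" where
  "extend B acc a = foldl (\<lambda>acc2 f. foldl (\<lambda>acc3 b. Node (Node (Node a b) f) acc3) acc2 (elems B))
     Leaf (elems acc)"

lemma elems_extend_inner:
  "elems (foldl (\<lambda>acc3 b. Node (Node (Node a b) f) acc3) acc bs)
     = rev (map (\<lambda>b. Node (Node a b) f) bs) @ elems acc"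
  by (induction bs arbitrary: acc) auto

lemma elems_extend_prefix:
  "set (elems (foldl (\<lambda>acc2 f. foldl (\<lambda>acc3 b. Node (Node (Node a b) f) acc3) acc2 (elems B)) d fs))
     = {Node (Node a b) f |b f. b \<in> set (elems B) \<and> f \<in> set fs} \<union> set (elems d)"
  "len (foldl (\<lambda>acc2 f. foldl (\<lambda>acc3 b. Node (Node (Node a b) f) acc3) acc2 (elems B)) d fs)
     = length fs * len B + len d"
  by (induction fs arbitrary: d) (auto simp: elems_extend_inner)

lemma set_extend:
  "set (elems (extend B acc a)) = {Node (Node a b) f |b f. b \<in> set (elems B) \<and> f \<in> set (elems acc)}"
  by (simp add: extend_def elems_extend_prefix)

lemma len_extend: "len (extend B acc a) = len acc * len B"
  by (simp add: extend_def elems_extend_prefix)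

lemma eval_funs_t: "eval funs_t (Node A (Node B z)) = foldl (extend B) (Node Leaf Leaf) (elems A)"
  by (simp add: funs_t_def extend_def[abs_def])

lemma len_extends: "len (foldl (extend B) (Node Leaf Leaf) as) = len B ^ length as"
  by (induction as rule: rev_induct) (simp_all add: len_extend)

lemma set_extends:
  assumes "distinct xs"
  shows "set (elems (foldl (extend (codes ys)) (Node Leaf Leaf) (map encode_nat xs)))
     = {graph_of (rev xs) f |f. f ` set xs \<subseteq> set ys}"
  using assms
proof (induction xs rule: rev_induct)
  case Nil
  show ?case by (auto simp: graph_of_def)
next
  case (snoc x xs)
  have "set (elems (foldl (extend (codes ys)) (Node Leaf Leaf) (map encode_nat (xs @ [x]))))
    = {Node (Node (encode_nat x) (encode_nat y)) (graph_of (rev xs) f) |y f. y \<in> set ys \<and> f ` set xs \<subseteq> set ys}"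
    using snoc by (auto simp: set_extend)
  also have "\<dots> = {graph_of (rev (xs @ [x])) f |f. f ` set (xs @ [x]) \<subseteq> set ys}"
  proof (intro equalityI subsetI)
    fix d assume "d \<in> {Node (Node (encode_nat x) (encode_nat y)) (graph_of (rev xs) f) |y f. y \<in> set ys \<and> f ` set xs \<subseteq> set ys}"
    then obtain y f where d: "d = Node (Node (encode_nat x) (encode_nat y)) (graph_of (rev xs) f)"
      "y \<in> set ys" "f ` set xs \<subseteq> set ys" by blast
    \<comment> \<open>Since \<open>x\<close> is a new argument, the update does not disturb the
      earlier pairs.\<close>
    have "graph_of (rev xs) (f(x := y)) = graph_of (rev xs) f"
      unfolding graph_of_def using snoc.prems by (intro arg_cong[of _ _ encode_list] map_cong) auto
    then have "d = graph_of (rev (xs @ [x])) (f(x := y))"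
      unfolding d by (simp add: graph_of_def)
    moreover have "(f(x := y)) ` set (xs @ [x]) \<subseteq> set ys" using d snoc.prems by auto
    ultimately show "d \<in> {graph_of (rev (xs @ [x])) f |f. f ` set (xs @ [x]) \<subseteq> set ys}" by blast
  qed (auto simp: graph_of_def)
  finally show ?case .
qed

lemma set_funs_t:
  assumes "distinct xs"
  shows "set (elems (eval funs_t (Node (codes xs) (Node (codes ys) z))))
    = {graph_of (rev xs) f |f. f ` set xs \<subseteq> set ys}"
  using set_extends[OF assms] by (simp add: eval_funs_t)

lemma len_funs_t: "len (eval funs_t (Node A (Node B z))) = len B ^ len A"
  by (simp add: eval_funs_t len_extends)

lemma bounded_funs_t:
  assumes "1 \<le> N" "len A \<le> N" "len B \<le> N" "len B ^ len A \<le> N"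
  shows "bounded N funs_t (Node A (Node B z))"
proof -
  have "len B ^ k \<le> N" if "k < len A" for k
  \<comment> \<open>Powers of 0 are not increasing: the initial list has one element even if the
    final one is empty, hence the assumption that \<open>N\<close> is positive.\<close>
  proof (cases "len B = 0")
    case True
    then show ?thesis using assms(1) by (cases k) auto
  next
    case False
    then have "len B ^ k \<le> len B ^ len A" using that by (intro power_increasing) (auto simp: Suc_le_eq)
    then show ?thesis using assms(4) by simp
  qed
  moreover have "(\<lambda>acc a. foldl (\<lambda>acc f. foldl (\<lambda>acc b. Node (Node (Node a b) f) acc) acc (elems B))
      Leaf (elems acc)) = extend B"
    by (intro ext) (simp add: extend_def)
  ultimately show ?thesis
    using assms(2,3) by (simp add: funs_t_def len_extends)
qed

section \<open>The greedy procedures on lists of naturals\<close>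

definition cover_step :: "(nat \<Rightarrow> nat \<Rightarrow> bool) \<Rightarrow> nat \<Rightarrow> nat list \<Rightarrow> nat \<Rightarrow> nat list" where
  "cover_step E i acc j = (if E i j \<and> i \<notin> set acc \<and> j \<notin> set acc then i # j # acc else acc)"

definition cover_list :: "(nat \<Rightarrow> nat \<Rightarrow> bool) \<Rightarrow> nat list \<Rightarrow> nat list" where
  "cover_list E xs = foldl (\<lambda>acc i. foldl (cover_step E i) acc xs) [] xs"

definition reps_step :: "(nat \<Rightarrow> nat \<Rightarrow> bool) \<Rightarrow> nat set \<Rightarrow> nat list \<Rightarrow> nat \<Rightarrow> nat list" where
  "reps_step E S acc u = (if u \<notin> S \<and> (\<exists>s\<in>S. E u s) \<and> (\<forall>v\<in>set acc. \<exists>s\<in>S. E u s \<noteq> E v s)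
     then u # acc else acc)"

definition reps_list :: "(nat \<Rightarrow> nat \<Rightarrow> bool) \<Rightarrow> nat set \<Rightarrow> nat list \<Rightarrow> nat list" where
  "reps_list E S xs = foldl (reps_step E S) [] xs"

lemma codes_Cons: "codes (x # xs) = Node (encode_nat x) (codes xs)"
  by (simp add: codes_def)

lemma codes_Nil [simp]: "codes [] = Leaf"
  by (simp add: codes_def)

lemma eval_cover_step_t:
  "eval cover_step_t (Node (encode_nat j) (Node (codes acc) (Node (encode_nat i) (Node y (Node G z)))))
     = codes (cover_step (edge G) i acc j)"
  unfolding cover_step_t_def eval_TIf by (auto simp: cover_step_def codes_Cons)

text \<open>Stated for an arbitrary list in place of the full vertex list, because
  \<open>bounded\<close> refers to the accumulator after each prefix of the loop.\<close>

lemma eval_cover_row: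
  "foldl (\<lambda>acc x. eval cover_step_t (Node x (Node acc (Node (encode_nat i) (Node y (Node G z))))))
     (codes acc) (map encode_nat js)
   = codes (foldl (cover_step (edge G) i) acc js)"
  by (rule foldl_map_sim) (rule eval_cover_step_t)

lemma eval_cover_prefix:
  "foldl (\<lambda>acc x. eval (TFold (verts_t (var 2)) (var 1) cover_step_t) (Node x (Node acc (Node G z))))
     (codes acc) (map encode_nat is)
   = codes (foldl (\<lambda>acc i. foldl (cover_step (edge G) i) acc (rev [0..<len G])) acc is)"
  by (rule foldl_map_sim) (simp add: eval_cover_row)

lemma eval_cover_t: "eval cover_t (Node G z) = codes (cover_list (edge G) (rev [0..<len G]))"
  using eval_cover_prefix[of G z "[]" "rev [0..<len G]"]
  by (simp add: cover_t_def cover_list_def)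

lemma eval_reps_step_t:
  "eval reps_step_t (Node (encode_nat u) (Node (codes acc) (Node (codes S) (Node G z))))
     = codes (reps_step (edge G) (set S) acc u)"
  unfolding reps_step_t_def eval_TIf by (auto simp: reps_step_def codes_Cons)

lemma eval_reps_prefix:
  "foldl (\<lambda>acc x. eval reps_step_t (Node x (Node acc (Node (codes S) (Node G z)))))
     (codes acc) (map encode_nat us)
   = codes (foldl (reps_step (edge G) (set S)) acc us)"
  by (rule foldl_map_sim) (rule eval_reps_step_t)

lemma eval_reps_t:
  "eval reps_t (Node (codes S) (Node G z)) = codes (reps_list (edge G) (set S) (rev [0..<len G]))"
  using eval_reps_prefix[of S G z "[]" "rev [0..<len G]"]
  by (simp add: reps_t_def reps_list_def)

lemma holds_place_t:
  "holds place_t (Node (encode_nat w) (Node (encode_nat r) (Node (graph_of xs f) (Node G (Node H z)))))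
     \<longleftrightarrow> place (edge G) (edge H) (set xs) f w r"
  by (simp add: place_t_def place_def)

lemma holds_separated_t:
  "holds separated_t (Node (encode_nat r) (Node (encode_nat q) (Node (graph_of xs f) (Node G z))))
     \<longleftrightarrow> separated (edge G) (set xs) r q"
  by (simp add: separated_t_def separated_def)

lemma holds_valid_t:
  "holds valid_t (Node (graph_of xs f) (Node P (Node S (Node G (Node H z)))))
     \<longleftrightarrow> valid (edge G) (edge H) (set xs) f"
  by (auto simp: valid_t_def valid_def)

lemma holds_step_t:
  "holds step_t (Node (graph_of ys h) (Node (graph_of ys g) (Node (encode_nat w)
       (Node (graph_of xs f) (Node G (Node H z))))))
     \<longleftrightarrow> family_step (place (edge G) (edge H) (set xs) f) (separated (edge G) (set xs)) (set ys) w g h"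
  by (auto simp: step_t_def family_step_def holds_place_t holds_separated_t)

section \<open>Greedy covers and representatives\<close>

text \<open>Every edge added by the greedy matching contains a vertex of each cover \<open>C\<close>.\<close>

definition cover_inv :: "nat \<Rightarrow> nat set \<Rightarrow> nat list \<Rightarrow> bool" where
  "cover_inv n C acc \<longleftrightarrow> distinct acc \<and> set acc \<subseteq> {..<n} \<and> length acc \<le> 2 * card (C \<inter> set acc)"

lemma cover_inv_step:
  assumes "cover_inv n C acc" "i < n" "j < n" "i \<noteq> j" "E i j \<Longrightarrow> i \<in> C \<or> j \<in> C" 
  shows "cover_inv n C (cover_step E i acc j)"
proof (cases "E i j \<and> i \<notin> set acc \<and> j \<notin> set acc")
  case True
  \<comment> \<open>An added edge lengthens the list by two, and its endpoint in \<open>C\<close>,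
    being new, enlarges the intersection by at least one.\<close>
  have "C \<inter> set acc \<subset> C \<inter> set (i # j # acc)" using True assms(5) by auto
  then have "card (C \<inter> set acc) < card (C \<inter> set (i # j # acc))" by (intro psubset_card_mono) auto
  then show ?thesis using True assms by (auto simp: cover_inv_def cover_step_def)
qed (use assms in \<open>auto simp: cover_step_def\<close>)

lemma cover_inv_row:
  assumes "\<And>u v. E u v \<Longrightarrow> u \<in> C \<or> v \<in> C" "\<And>u. \<not> E u u" "i < n" "set js \<subseteq> {..<n}" "cover_inv n C acc"
  shows "cover_inv n C (foldl (cover_step E i) acc js)"
  using assms(4,5)
proof (induction js arbitrary: acc)
  case (Cons j js)
  have "cover_inv n C (cover_step E i acc j)"
  proof (cases "i = j")
    case True
    then show ?thesis using Cons assms(2) by (simp add: cover_step_def)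
  qed (use Cons assms in \<open>auto intro: cover_inv_step\<close>)
  then show ?case using Cons by simp
qed simp

lemma cover_inv_rows:
  assumes "\<And>u v. E u v \<Longrightarrow> u \<in> C \<or> v \<in> C" "\<And>u. \<not> E u u" "set is \<subseteq> {..<n}" "set js \<subseteq> {..<n}"
  shows "cover_inv n C (foldl (\<lambda>acc i. foldl (cover_step E i) acc js) [] is)"
  using assms(3)
proof (induction "is" rule: rev_induct)
  case (snoc i "is")
  then show ?case using assms by (auto intro: cover_inv_row)
qed (simp add: cover_inv_def)

lemma set_cover_row: "set acc \<subseteq> set (foldl (cover_step E i) acc js)"
proof (induction js arbitrary: acc)
  case (Cons j js)
  have "set acc \<subseteq> set (cover_step E i acc j)" by (auto simp: cover_step_def)
  then show ?case using Cons[of "cover_step E i acc j"] by simp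
qed simp

text \<open>Maximality of the matching: an edge is passed over only if an endpoint is already
  present, and entries never leave the list.\<close>

lemma cover_row_covers:
  assumes "j \<in> set js" "E i j"
  shows "i \<in> set (foldl (cover_step E i) acc js) \<or> j \<in> set (foldl (cover_step E i) acc js)"
  using assms(1)
proof (induction js arbitrary: acc)
  case (Cons j' js)
  show ?case
  proof (cases "j = j'")
    case True
    have "i \<in> set (cover_step E i acc j) \<or> j \<in> set (cover_step E i acc j)"
      using assms(2) by (auto simp: cover_step_def)
    then show ?thesis using True set_cover_row[of "cover_step E i acc j'" E i js] by auto
  qed (use Cons in simp)
qed simp

lemma cover_rows_cover:
  assumes "i \<in> set is" "j \<in> set js" "E i j"
  shows "i \<in> set (foldl (\<lambda>acc i. foldl (cover_step E i) acc js) acc is) \<or>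
    j \<in> set (foldl (\<lambda>acc i. foldl (cover_step E i) acc js) acc is)"
  using assms(1)
proof (induction "is" rule: rev_induct)
  case (snoc i' "is")
  then show ?case
    using set_cover_row[of "foldl (\<lambda>acc i. foldl (cover_step E i) acc js) acc is" E i' js]
      cover_row_covers[where E = E and i = i, OF assms(2,3)] by auto
qed simp

definition reps_inv :: "nat \<Rightarrow> (nat \<Rightarrow> nat \<Rightarrow> bool) \<Rightarrow> nat set \<Rightarrow> nat list \<Rightarrow> bool" where
  "reps_inv n E S acc \<longleftrightarrow> distinct acc \<and> (\<forall>r\<in>set acc. r < n \<and> r \<notin> S \<and> (\<exists>s\<in>S. E r s)) \<and>
     inj_on (\<lambda>r. {s\<in>S. E r s}) (set acc)"

lemma reps_inv_step: "reps_inv n E S acc \<Longrightarrow> u < n \<Longrightarrow> reps_inv n E S (reps_step E S acc u)"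
  unfolding reps_inv_def reps_step_def by (auto simp: inj_on_insert)

lemma reps_inv_foldl: "set us \<subseteq> {..<n} \<Longrightarrow> reps_inv n E S (foldl (reps_step E S) [] us)"
  by (induction us rule: rev_induct) (auto simp: reps_inv_step, simp add: reps_inv_def)

text \<open>When \<open>u\<close> is processed it either becomes a representative or is turned away
  by an earlier one with the same neighbours in \<open>S\<close>.\<close>

lemma reps_cover:
  assumes "u \<in> set us" "u \<notin> S" "s \<in> S" "E u s"
  shows "\<exists>r\<in>set (foldl (reps_step E S) acc us). \<forall>s\<in>S. E u s \<longleftrightarrow> E r s"
  using assms(1)
proof (induction us rule: rev_induct)
  case (snoc v us)
  then show ?case using assms(2-4) by (auto simp: reps_step_def)
qed simp

text \<open>Representatives are told apart by their neighbourhoods, which are subsets of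
  \<open>S\<close>.\<close>

lemma reps_inv_length:
  assumes "reps_inv n E S acc" "finite S"
  shows "length acc \<le> 2 ^ card S"
proof -
  have "card (set acc) \<le> card (Pow S)"
    using assms by (intro card_inj_on_le[of "\<lambda>r. {s\<in>S. E r s}"]) (auto simp: reps_inv_def)
  then show ?thesis using assms by (simp add: reps_inv_def distinct_card card_Pow)
qed

lemma reps_inv_length_less:
  assumes "reps_inv n E S acc"
  shows "length acc \<le> n"
proof -
  have "card (set acc) \<le> card {..<n}"
    using assms by (intro card_mono) (auto simp: reps_inv_def)
  then show ?thesis using assms by (simp add: reps_inv_def distinct_card)
qed

lemma cover_inv_length_less:
  assumes "cover_inv n C acc"
  shows "length acc \<le> n"
proof -
  have "card (set acc) \<le> card {..<n}"
    using assms by (intro card_mono) (auto simp: cover_inv_def)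
  then show ?thesis using assms by (simp add: cover_inv_def distinct_card)
qed

section \<open>List lengths in the subprograms\<close>

lemma bounded_place_t:
  assumes "length xs \<le> N" "w \<le> N" "r \<le> N" "\<And>x. x \<in> set xs \<Longrightarrow> x \<le> N \<and> f x \<le> N"
  shows "bounded N place_t (Node (encode_nat w) (Node (encode_nat r) (Node (graph_of xs f) (Node G (Node H z)))))"
  using assms by (simp add: place_t_def)

lemma bounded_separated_t:
  assumes "length xs \<le> N" "r \<le> N" "q \<le> N" "\<And>x. x \<in> set xs \<Longrightarrow> x \<le> N \<and> f x \<le> N"
  shows "bounded N separated_t (Node (encode_nat r) (Node (encode_nat q) (Node (graph_of xs f) (Node G z))))"
  using assms by (simp add: separated_t_def)

lemma bounded_valid_t:
  assumes "length xs \<le> N" "\<And>x. x \<in> set xs \<Longrightarrow> x \<le> N \<and> f x \<le> N"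
  shows "bounded N valid_t (Node (graph_of xs f) (Node P (Node S (Node G (Node H z)))))"
  using assms by (simp add: valid_t_def)

lemma bounded_step_t:
  assumes "length xs \<le> N" "length ys \<le> N" "w \<le> N" "\<And>x. x \<in> set xs \<Longrightarrow> x \<le> N \<and> f x \<le> N"
    "\<And>y. y \<in> set ys \<Longrightarrow> y \<le> N \<and> g y \<le> N \<and> h y \<le> N"
  shows "bounded N step_t (Node (graph_of ys h) (Node (graph_of ys g) (Node (encode_nat w)
       (Node (graph_of xs f) (Node G (Node H z))))))"
  using assms by (simp add: step_t_def bounded_place_t bounded_separated_t) (meson le_trans)

lemma bounded_cover_step_t:
  assumes "i \<le> N" "j \<le> N" "length acc \<le> N" "\<And>x. x \<in> set acc \<Longrightarrow> x \<le> N"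
  shows "bounded N cover_step_t (Node (encode_nat j) (Node (codes acc) (Node (encode_nat i) (Node y (Node G z)))))"
  unfolding cover_step_t_def bounded_TIf using assms by auto

lemma bounded_reps_step_t:
  assumes "u \<le> N" "length acc \<le> N" "length S \<le> N" "\<And>x. x \<in> set acc \<union> set S \<Longrightarrow> x \<le> N"
  shows "bounded N reps_step_t (Node (encode_nat u) (Node (codes acc) (Node (codes S) (Node G z))))"
  unfolding reps_step_t_def bounded_TIf using assms by auto

lemma bounded_cover_t:
  assumes irrefl: "\<And>u. \<not> edge G u u" and N: "len G \<le> N"
  shows "bounded N cover_t (Node G z)"
proof -
  let ?n = "len G" and ?E = "edge G" and ?xs = "rev [0..<len G]"
  let ?acc = "\<lambda>k. foldl (\<lambda>acc i. foldl (cover_step ?E i) acc ?xs) [] (take k ?xs)"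
  \<comment> \<open>Every graph is covered by \<open>UNIV\<close>, so the invariant is available at
    once; distinctness and range of the entries then bound the length.\<close>
  have inv: "cover_inv ?n UNIV (?acc k)" for k
    by (rule cover_inv_rows) (use irrefl in \<open>auto dest: in_set_takeD\<close>)
  have inv': "cover_inv ?n UNIV (foldl (cover_step ?E i) (?acc k) (take l ?xs))" if "i < ?n" for i k l
    by (rule cover_inv_row) (use irrefl that inv in \<open>auto dest: in_set_takeD\<close>)
  have le: "length acc \<le> N" "x \<in> set acc \<Longrightarrow> x \<le> N" if "cover_inv ?n UNIV acc" for acc x
    using cover_inv_length_less[OF that] that N by (auto simp: cover_inv_def)
  have row: "bounded N (TFold (verts_t (var 2)) (var 1) cover_step_t)
      (Node (encode_nat i) (Node (codes (?acc k)) (Node G z)))" if i: "i < ?n" for i k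
  proof -
    have "bounded N cover_step_t (Node (map encode_nat ?xs ! l)
       (Node (foldl (\<lambda>acc x. eval cover_step_t (Node x (Node acc (Node (encode_nat i) (Node (codes (?acc k)) (Node G z))))))
          (codes (?acc k)) (take l (map encode_nat ?xs)))
        (Node (encode_nat i) (Node (codes (?acc k)) (Node G z)))))" if l: "l < ?n" for l
      unfolding take_map eval_cover_row using l i N le[OF inv'[OF i]]
      by (simp add: rev_nth bounded_cover_step_t)
    then show ?thesis using N by simp
  qed
  have "bounded N (TFold (verts_t (var 2)) (var 1) cover_step_t) (Node (map encode_nat ?xs ! k)
      (Node (foldl (\<lambda>acc x. eval (TFold (verts_t (var 2)) (var 1) cover_step_t) (Node x (Node acc (Node G z))))
         (codes []) (take k (map encode_nat ?xs))) (Node G z)))" if "k < ?n" for k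
    unfolding take_map eval_cover_prefix using row that by (simp add: rev_nth del: bounded.simps eval.simps)
  then show ?thesis
    unfolding cover_t_def bounded.simps(8) using N by (simp del: bounded.simps(8) eval.simps(8))
qed

lemma bounded_reps_t:
  assumes "len G \<le> N" "length S \<le> N" "set S \<subseteq> {..<len G}"
  shows "bounded N reps_t (Node (codes S) (Node G z))"
proof -
  let ?n = "len G" and ?E = "edge G" and ?xs = "rev [0..<len G]"
  let ?acc = "\<lambda>k. foldl (reps_step ?E (set S)) [] (take k ?xs)"
  have inv: "reps_inv ?n ?E (set S) (?acc k)" for k
    by (rule reps_inv_foldl) (auto dest: in_set_takeD)
  have le: "length (?acc k) \<le> N" "x \<in> set (?acc k) \<Longrightarrow> x \<le> N" for k x
    using reps_inv_length_less[OF inv] inv[of k] assms(1) by (auto simp: reps_inv_def intro: le_trans)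
  have "bounded N reps_step_t (Node (map encode_nat ?xs ! k)
      (Node (foldl (\<lambda>acc x. eval reps_step_t (Node x (Node acc (Node (codes S) (Node G z)))))
         (codes []) (take k (map encode_nat ?xs))) (Node (codes S) (Node G z))))" if "k < ?n" for k
    unfolding take_map eval_reps_prefix using assms le that by (auto simp: rev_nth intro!: bounded_reps_step_t)
  then show ?thesis
    unfolding reps_t_def using assms(1) by simp
qed

section \<open>Correctness\<close>

lemma encode_nat_eq_Leaf [simp]: "encode_nat n = Leaf \<longleftrightarrow> n = 0"
  by (cases n) auto

lemma bex_image_Collect: "(\<exists>x\<in>{c g |g. B g}. R x) \<longleftrightarrow> (\<exists>g. B g \<and> R (c g))"
  by blast

lemma set_vectors:
  assumes "distinct P"
  shows "set (elems (eval funs_t (Node (codes P) (Node (codes (n # rev [0..<n])) z))))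
    = {graph_of (rev P) h |h. \<forall>r\<in>set P. h r \<le> n}"
proof -
  have "set (n # rev [0..<n]) = {..n}" by auto
  then show ?thesis unfolding set_funs_t[OF assms] by auto
qed

lemma reach_init:
  assumes "distinct P"
  shows "set (elems (eval reach_init_t (Node Phi (Node (codes P) (Node S (Node G z))))))
    = {graph_of (rev P) h |h. (\<forall>r\<in>set P. h r \<le> len G) \<and> (\<forall>r\<in>set P. h r = 0)}"
  by (auto simp: reach_init_t_def set_vectors[OF assms])

text \<open>\<open>Q\<close> is the property that characterises the vectors reached so far; in the
  induction over the hosts it becomes \<open>family\<close> for those already treated.\<close>

lemma reach_step:
  assumes P: "distinct P"
    and acc: "set (elems acc) = {graph_of (rev P) g |g. (\<forall>r\<in>set P. g r \<le> len G) \<and> Q g}"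
  shows "set (elems (eval reach_step_t (Node (encode_nat w) (Node acc
      (Node (graph_of S f) (Node (codes P) (Node S' (Node G (Node H z)))))))))
    = {graph_of (rev P) h |h. (\<forall>r\<in>set P. h r \<le> len G) \<and>
        (\<exists>g. Q g \<and> family_step (place (edge G) (edge H) (set S) f) (separated (edge G) (set S)) (set P) w g h)}"
proof -
  let ?st = "family_step (place (edge G) (edge H) (set S) f) (separated (edge G) (set S)) (set P) w"
  \<comment> \<open>Steps never decrease an entry, so predecessors of a vector with entries at most
    \<open>len G\<close> are of the same kind, and enumerating only these loses nothing.\<close>
  have "(\<forall>r\<in>set P. h r \<le> len G) \<and> (\<exists>g. (\<forall>r\<in>set P. g r \<le> len G) \<and> Q g \<and> ?st g h) \<longleftrightarrow>
      (\<forall>r\<in>set P. h r \<le> len G) \<and> (\<exists>g. Q g \<and> ?st g h)" for h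
    using family_step_le le_trans by meson
  moreover have "set (elems (eval reach_step_t (Node (encode_nat w) (Node acc
      (Node (graph_of S f) (Node (codes P) (Node S' (Node G (Node H z)))))))))
    = {graph_of (rev P) h |h. (\<forall>r\<in>set P. h r \<le> len G) \<and>
        (\<exists>g. (\<forall>r\<in>set P. g r \<le> len G) \<and> Q g \<and> ?st g h)}"
  proof -
    let ?e = "Node (encode_nat w) (Node (graph_of S f) (Node G (Node H Leaf)))"
    have "set (elems (eval reach_step_t (Node (encode_nat w) (Node acc
        (Node (graph_of S f) (Node (codes P) (Node S' (Node G (Node H z)))))))))
      = {v \<in> {graph_of (rev P) h |h. \<forall>r\<in>set P. h r \<le> len G}.
          \<exists>u\<in>set (elems acc). holds step_t (Node v (Node u ?e))}"
      by (auto simp: reach_step_t_def set_vectors[OF P])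
    also have "\<dots> = {graph_of (rev P) h |h. (\<forall>r\<in>set P. h r \<le> len G) \<and> (\<exists>g. (\<forall>r\<in>set P. g r \<le> len G) \<and> Q g \<and>
        holds step_t (Node (graph_of (rev P) h) (Node (graph_of (rev P) g) ?e)))}"
      unfolding acc by blast
    finally show ?thesis by (simp add: holds_step_t)
  qed
  ultimately show ?thesis by (simp only:)
qed

text \<open>Correctness of the dynamic program, with \<open>family_insert\<close> as its recurrence.
  Intermediate host lists are covered because the length analysis needs the states of every
  round.\<close>

lemma reach_prefix:
  assumes P: "distinct P" and "distinct ws"
  shows "set (elems (foldl (\<lambda>acc x. eval reach_step_t (Node x (Node acc
       (Node (graph_of S f) (Node (codes P) (Node S' (Node G (Node H z))))))))
      (eval reach_init_t (Node (graph_of S f) (Node (codes P) (Node S' (Node G (Node H z))))))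
      (map encode_nat ws)))
    = {graph_of (rev P) h |h. (\<forall>r\<in>set P. h r \<le> len G) \<and>
        family (place (edge G) (edge H) (set S) f) (separated (edge G) (set S)) (set P) (set ws) h}"
  using assms(2)
proof (induction ws rule: rev_induct)
  case Nil
  show ?case by (simp add: reach_init[OF P] family_empty)
next
  case (snoc w ws)
  then have ws: "distinct ws" "w \<notin> set ws" by auto
  from reach_step[OF P snoc.IH[OF ws(1)]] show ?case
    by (simp add: family_insert[OF finite_set ws(2)])
qed

lemma length_filter_upt: "length (filter Q (rev [0..<n])) = card {u. u < n \<and> Q u}"
proof -
  have "length (filter Q (rev [0..<n])) = card (set (filter Q (rev [0..<n])))"
    by (rule distinct_card[symmetric]) simp
  also have "set (filter Q (rev [0..<n])) = {u. u < n \<and> Q u}" by auto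
  finally show ?thesis .
qed

text \<open>The list of twins serves as its own unary cardinality, ready to be compared by
  \<open>eq_t\<close>.\<close>

lemma len_count_t:
  "len (eval count_t (Node (Node (encode_nat r) y) (Node v (Node Phi (Node P' (Node (codes S) (Node G z)))))))
    = card (twins (len G) (edge G) (set S) r)"
proof -
  have "len (eval count_t (Node (Node (encode_nat r) y) (Node v (Node Phi (Node P' (Node (codes S) (Node G z)))))))
    = length (filter (\<lambda>u. u \<notin> set S \<and> (\<forall>s\<in>set S. edge G u s \<longleftrightarrow> edge G r s)) (rev [0..<len G]))"
    by (auto simp: count_t_def filter_map o_def intro!: arg_cong[of _ _ length] filter_cong)
  then show ?thesis by (simp only: length_filter_upt twins_def)
qed

lemma card_twins_le: "card (twins n E S r) \<le> n"
proof -
  have "card (twins n E S r) \<le> card {..<n}" by (intro card_mono) (auto simp: twins_def)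
  then show ?thesis by simp
qed

lemma family_cong: "(\<And>r. r \<in> P \<Longrightarrow> h r = h' r) \<Longrightarrow> family A D P X h \<longleftrightarrow> family A D P X h'"
  unfolding family_def by simp

lemma elems_reach_t:
  assumes P: "distinct P"
  shows "set (elems (eval reach_t (Node (graph_of S f) (Node (codes P) (Node S' (Node G (Node H z)))))))
    = {graph_of (rev P) h |h. (\<forall>r\<in>set P. h r \<le> len G) \<and>
        family (place (edge G) (edge H) (set S) f) (separated (edge G) (set S)) (set P) {..<len H} h}"
proof -
  have hosts: "set (rev [0..<len H]) = {..<len H}" by auto
  show ?thesis
    using reach_prefix[OF P, of "rev [0..<len H]" S f S' G H z, unfolded hosts]
    unfolding reach_t_def by simp
qed

lemma holds_dp_t:
  assumes P: "distinct P"
  shows "holds dp_t (Node (graph_of (rev S) f) (Node (codes P) (Node (codes S) (Node G (Node H z)))))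
    \<longleftrightarrow> family (place (edge G) (edge H) (set S) f) (separated (edge G) (set S)) (set P) {..<len H}
          (\<lambda>r. card (twins (len G) (edge G) (set S) r))"
proof -
  let ?fam = "family (place (edge G) (edge H) (set S) f) (separated (edge G) (set S)) (set P) {..<len H}"
  let ?c = "\<lambda>r. card (twins (len G) (edge G) (set S) r)"
  have "holds dp_t (Node (graph_of (rev S) f) (Node (codes P) (Node (codes S) (Node G (Node H z)))))
    \<longleftrightarrow> (\<exists>h. (\<forall>r\<in>set P. h r \<le> len G) \<and> ?fam h \<and> (\<forall>r\<in>set P. h r = ?c r))"
    unfolding dp_t_def holds_filter_t elems_reach_t[OF P] bex_image_Collect by (simp add: len_count_t)
  also have "\<dots> \<longleftrightarrow> ?fam ?c"
    \<comment> \<open>The desired vector has entries at most \<open>len G\<close>, so it is among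
      the enumerated ones.\<close>
    using family_cong[of "set P" _ ?c] card_twins_le by (metis (no_types, lifting))
  finally show ?thesis .
qed

section \<open>Correctness of the search on validated matrices\<close>

definition li_exists :: "data \<Rightarrow> data \<Rightarrow> bool" where
  "li_exists G H \<longleftrightarrow> (\<exists>f. li_hom (len G) (len H) (edge G) (edge H) f)"

locale checked =
  fixes G H :: data
  assumes G_less: "edge G u v \<Longrightarrow> u < len G" and G_sym: "edge G u v \<Longrightarrow> edge G v u"
    and G_irrefl: "\<not> edge G u u" and H_sym: "edge H u v \<Longrightarrow> edge H v u"
begin

abbreviation cover :: "nat list" where
  "cover \<equiv> cover_list (edge G) (rev [0..<len G])"

abbreviation reps :: "nat list" where
  "reps \<equiv> reps_list (edge G) (set cover) (rev [0..<len G])"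

lemma cover_inv:
  assumes "\<And>u v. edge G u v \<Longrightarrow> u \<in> C \<or> v \<in> C"
  shows "cover_inv (len G) C cover"
  unfolding cover_list_def using assms G_irrefl by (intro cover_inv_rows) auto

lemma cover_props: "distinct cover" "set cover \<subseteq> {..<len G}" "length cover \<le> len G"
  using cover_inv[of UNIV] cover_inv_length_less[OF cover_inv[of UNIV]] by (auto simp: cover_inv_def)

lemma cover_covers: "edge G u v \<Longrightarrow> u \<in> set cover \<or> v \<in> set cover"
  unfolding cover_list_def using G_less G_sym by (intro cover_rows_cover) auto

lemma reps_inv: "reps_inv (len G) (edge G) (set cover) reps"
  unfolding reps_list_def by (rule reps_inv_foldl) auto

sublocale guest_host "len G" "len H" "edge G" "edge H" "set cover" "set reps"
proof
  show "r < len G \<and> r \<notin> set cover \<and> (\<exists>s\<in>set cover. edge G r s)" if "r \<in> set reps" for r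
    using that reps_inv by (auto simp: reps_inv_def)
  show "\<exists>r\<in>set reps. \<forall>s\<in>set cover. edge G u s \<longleftrightarrow> edge G r s"
    if "u < len G" "u \<notin> set cover" "s \<in> set cover" "edge G u s" for u s
    unfolding reps_list_def using that by (intro reps_cover) auto
  show "r = q" if "r \<in> set reps" "q \<in> set reps" "\<And>s. s \<in> set cover \<Longrightarrow> edge G r s \<longleftrightarrow> edge G q s" for r q
    using reps_inv that unfolding reps_inv_def inj_on_def by blast
qed (use G_less G_sym G_irrefl H_sym cover_props cover_covers in auto)

lemma holds_solve_t: "holds solve_t (Node G (Node H z)) \<longleftrightarrow> li_exists G H"
proof -
  have d: "distinct reps" using reps_inv by (simp add: reps_inv_def)
  have maps: "set (elems (eval (TComp funs_t (list_t [var 1, verts_t (var 3)]))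
      (Node (codes reps) (Node (codes cover) (Node G (Node H z))))))
    = {graph_of (rev cover) f |f. f ` set cover \<subseteq> {..<len H}}"
    by (simp add: set_funs_t[OF cover_props(1)] atLeast0LessThan)
  have "holds search_t (Node (codes reps) (Node (codes cover) (Node G (Node H z))))
    \<longleftrightarrow> (\<exists>f. (\<forall>s\<in>set cover. f s < len H) \<and> valid (edge G) (edge H) (set cover) f \<and>
       family (place (edge G) (edge H) (set cover) f) (separated (edge G) (set cover)) (set reps) {..<len H}
          (\<lambda>r. card (twins (len G) (edge G) (set cover) r)))"
    unfolding search_t_def holds_filter_t maps bex_image_Collect
    by (simp add: holds_valid_t holds_dp_t[OF d] image_subset_iff)
  then show ?thesis
    unfolding li_exists_def li_hom_iff by (auto simp: solve_t_def eval_cover_t eval_reps_t)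
qed

end

section \<open>List lengths and input validation\<close>

lemma bounded_count_t:
  assumes "len G \<le> N" "length S \<le> N" "\<And>s. s \<in> set S \<Longrightarrow> s \<le> N" "r \<le> N"
  shows "bounded N count_t
    (Node (Node (encode_nat r) y) (Node v (Node Phi (Node P' (Node (codes S) (Node G z))))))"
  using assms by (auto simp: count_t_def)

text \<open>Each round filters the enumeration of all vectors afresh, so the list of states stays
  below their number however many hosts there are.\<close>

lemma len_reach_le:
  "len (eval reach_init_t (Node Phi (Node (codes P) (Node S (Node G z))))) \<le> Suc (len G) ^ length P"
  "len (eval reach_step_t (Node w (Node acc (Node Phi (Node (codes P) (Node S (Node G z)))))))
     \<le> Suc (len G) ^ length P"
  unfolding reach_init_t_def reach_step_t_def elems_filter_t length_rev
  by (rule le_trans[OF length_filter_le], simp add: len_funs_t)+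

lemma bounded_dp_t:
  assumes P: "distinct P" and N: "1 \<le> N" "len H \<le> N" "length P \<le> N" "length S \<le> N"
      "Suc (len G) \<le> N" "Suc (len G) ^ length P \<le> N"
    and less: "\<And>s. s \<in> set S \<Longrightarrow> s \<le> N \<and> f s \<le> N" "\<And>r. r \<in> set P \<Longrightarrow> r \<le> N"
  shows "bounded N dp_t (Node (graph_of (rev S) f) (Node (codes P) (Node (codes S) (Node G (Node H z)))))"
proof -
  let ?e = "Node (graph_of (rev S) f) (Node (codes P) (Node (codes S) (Node G (Node H z))))"
  let ?ws = "rev [0..<len H]"
  let ?acc = "\<lambda>k. foldl (\<lambda>acc x. eval reach_step_t (Node x (Node acc ?e))) (eval reach_init_t ?e)
      (take k (map encode_nat ?ws))"
  have len_acc: "len (?acc k) \<le> N" for k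
  proof -
    have "len (foldl (\<lambda>acc x. eval reach_step_t (Node x (Node acc ?e))) (eval reach_init_t ?e) xs)
       \<le> Suc (len G) ^ length P" for xs
      by (cases xs rule: rev_cases) (simp_all add: len_reach_le)
    then show ?thesis using N(6) le_trans by blast
  qed
  have set_acc: "\<exists>g. u = graph_of (rev P) g \<and> (\<forall>r\<in>set P. g r \<le> len G)" if "u \<in> set (elems (?acc k))" for k u
  proof -
    have "distinct (take k ?ws)" by simp
    from reach_prefix[OF P this] that show ?thesis unfolding take_map by blast
  qed
  have funs: "bounded N funs_t (Node (codes P) (Node (codes (len G # rev [0..<len G])) Leaf))"
    using N by (intro bounded_funs_t) auto
  have vec: "\<exists>h. v = graph_of (rev P) h \<and> (\<forall>r\<in>set P. h r \<le> len G)"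
    if "v \<in> set (elems (eval funs_t (Node (codes P) (Node (codes (len G # rev [0..<len G])) Leaf))))" for v
    using that unfolding set_vectors[OF P] by blast
  have len_vecs: "len (eval funs_t (Node (codes P) (Node (codes (len G # rev [0..<len G])) Leaf))) \<le> N"
    using N(6) by (simp add: len_funs_t)
  have init: "bounded N reach_init_t ?e"
    using N(3,5) funs len_vecs vec by (fastforce simp: reach_init_t_def)
  have step: "bounded N reach_step_t (Node (encode_nat w) (Node (?acc k) ?e))" if w: "w \<le> N" for w k
  proof -
    have "bounded N step_t (Node v (Node u (Node (encode_nat w) (Node (graph_of (rev S) f) (Node G (Node H Leaf))))))"
      if uv: "v \<in> set (elems (eval funs_t (Node (codes P) (Node (codes (len G # rev [0..<len G])) Leaf))))"
        "u \<in> set (elems (?acc k))" for u v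
    proof -
      obtain g h where gh: "u = graph_of (rev P) g" "v = graph_of (rev P) h"
        "\<And>r. r \<in> set P \<Longrightarrow> g r \<le> len G \<and> h r \<le> len G"
        using vec[OF uv(1)] set_acc[OF uv(2)] by blast
      show ?thesis
        unfolding gh(1,2)
      proof (rule bounded_step_t)
        show "y \<le> N \<and> g y \<le> N \<and> h y \<le> N" if "y \<in> set (rev P)" for y
          using gh(3)[of y] less(2)[of y] N(5) that by simp
      qed (use N less w in auto)
    qed
    then show ?thesis using N(5) funs len_vecs len_acc by (simp add: reach_step_t_def)
  qed
  have "bounded N reach_step_t (Node (map encode_nat ?ws ! k) (Node (?acc k) ?e))" if "k < len H" for k
  proof -
    have "map encode_nat ?ws ! k = encode_nat (len H - Suc k)" using that by (simp add: rev_nth)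
    then show ?thesis using step[of "len H - Suc k"] N(2) by simp
  qed
  then have "bounded N reach_t ?e"
    unfolding reach_t_def using N(2) init by simp
  moreover have "eval reach_t ?e = ?acc (len H)" by (simp add: reach_t_def)
  moreover have "bounded N (all_t (var 0) (eq_t (snd_t 0) count_t)) (Node u ?e)"
    if acc: "u \<in> set (elems (?acc (len H)))" for u
  proof -
    obtain g where u: "u = graph_of (rev P) g" "\<And>r. r \<in> set P \<Longrightarrow> g r \<le> len G"
      using set_acc[OF acc] by blast
    have "card (twins (len G) (edge G) (set S) r) \<le> N" for r
      using card_twins_le[of "len G" "edge G" "set S" r] N(5) by linarith
    moreover have "g r \<le> N" if "r \<in> set P" for r using u(2)[OF that] N(5) by linarith
    ultimately show ?thesis
      unfolding u(1) using N less by (simp add: len_count_t bounded_count_t)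
  qed
  ultimately show ?thesis
    unfolding dp_t_def bounded_filter_t using len_acc[of "len H"] by simp
qed

context checked
begin

lemma bounded_solve_t:
  assumes N: "1 \<le> N" "len H \<le> N" "Suc (len G) \<le> N" "len H ^ length cover \<le> N"
    "Suc (len G) ^ length reps \<le> N"
  shows "bounded N solve_t (Node G (Node H z))"
proof -
  have reps: "distinct reps" "\<And>r. r \<in> set reps \<Longrightarrow> r < len G" "length reps \<le> len G"
    using reps_inv reps_inv_length_less[OF reps_inv] by (auto simp: reps_inv_def)
  have cover: "\<And>s. s \<in> set cover \<Longrightarrow> s < len G" using cover_props by auto
  let ?e = "Node (codes reps) (Node (codes cover) (Node G (Node H z)))"
  have maps: "eval (TComp funs_t (list_t [var 1, verts_t (var 3)])) ?e
      = eval funs_t (Node (codes cover) (Node (codes (rev [0..<len H])) Leaf))"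
    by simp
  have "bounded N (and_t valid_t dp_t) (Node phi ?e)"
    if phi: "phi \<in> set (elems (eval funs_t (Node (codes cover) (Node (codes (rev [0..<len H])) Leaf))))" for phi
  proof -
    obtain f where f: "phi = graph_of (rev cover) f" "f ` set cover \<subseteq> {..<len H}"
      using phi unfolding set_funs_t[OF cover_props(1)] by (auto simp: atLeast0LessThan)
    then have le: "s \<le> N \<and> f s \<le> N" if "s \<in> set cover" for s
      using cover[OF that] that N by fastforce
    have "bounded N valid_t (Node phi ?e)"
      unfolding f(1) using cover_props(3) N(3) le by (intro bounded_valid_t) auto
    moreover have "bounded N dp_t (Node phi ?e)"
      unfolding f(1)
    proof (rule bounded_dp_t)
      show "s \<le> N \<and> f s \<le> N" if "s \<in> set cover" for s by (rule le[OF that])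
      show "r \<le> N" if "r \<in> set reps" for r using reps(2)[OF that] N by linarith
    qed (use N reps cover_props in auto)
    ultimately show ?thesis by simp
  qed
  moreover have "bounded N (TComp funs_t (list_t [var 1, verts_t (var 3)])) ?e"
    using N cover_props(3) by (auto intro!: bounded_funs_t)
  moreover have "len (eval (TComp funs_t (list_t [var 1, verts_t (var 3)])) ?e) \<le> N"
    unfolding maps using N(4) by (simp add: len_funs_t)
  ultimately have "bounded N search_t ?e"
    unfolding search_t_def bounded_filter_t maps by blast
  moreover have "bounded N cover_t (Node G (Node H z))"
    using G_irrefl N by (intro bounded_cover_t) auto
  moreover have "bounded N reps_t (Node (codes cover) (Node G Leaf))"
    using cover_props N by (intro bounded_reps_t) auto
  ultimately show ?thesis
    by (simp add: solve_t_def eval_cover_t eval_reps_t)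
qed

end

section \<open>Recognising encodings of graphs\<close>

definition matrix :: "nat \<Rightarrow> (nat \<Rightarrow> nat \<Rightarrow> bool) \<Rightarrow> data" where
  "matrix n R = encode_list (map (\<lambda>i. encode_list (map (\<lambda>j. encode_bool (R i j)) [0..<n])) [0..<n])"

lemma len_matrix [simp]: "len (matrix n R) = n"
  by (simp add: matrix_def)

lemma encode_bool_eq_Leaf [simp]: "encode_bool b = Leaf \<longleftrightarrow> \<not> b"
  by (cases b) auto

lemma edge_matrix: "edge (matrix n R) i j \<longleftrightarrow> i < n \<and> j < n \<and> R i j"
  unfolding edge_def by (auto simp: nthd_elems matrix_def)

text \<open>An entry encodes a Boolean exactly if both its children are \<open>Leaf\<close>. With
  all rows of the right length, the tree is then determined by its relation
  \<open>edge\<close>.\<close>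

lemma holds_mat_t: "holds mat_t (Node M z) \<longleftrightarrow> M = matrix (len M) (edge M)"
proof
  assume "holds mat_t (Node M z)"
  then have row: "len r = len M" "\<And>d. d \<in> set (elems r) \<Longrightarrow> left d = Leaf \<and> right d = Leaf"
    if "r \<in> set (elems M)" for r
    using that by (auto simp: mat_t_def)
  have "elems M = map (\<lambda>i. encode_list (map (\<lambda>j. encode_bool (edge M i j)) [0..<len M])) [0..<len M]"
  proof (rule nth_equalityI)
    fix i assume i: "i < length (elems M)"
    then have r: "elems M ! i \<in> set (elems M)" by simp
    have "elems (elems M ! i) = map (\<lambda>j. encode_bool (edge M i j)) [0..<len M]"
    proof (rule nth_equalityI)
      fix j assume j: "j < len (elems M ! i)"
      let ?d = "elems (elems M ! i) ! j"
      have "left ?d = Leaf \<and> right ?d = Leaf" using row(2)[OF r] j by simp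
      then have "?d = encode_bool (?d \<noteq> Leaf)" by (cases ?d) auto
      moreover have "edge M i j \<longleftrightarrow> ?d \<noteq> Leaf" using i j by (simp add: edge_def nthd_elems)
      ultimately show "?d = map (\<lambda>j. encode_bool (edge M i j)) [0..<len M] ! j"
        using j row(1)[OF r] by simp
    qed (simp add: row(1)[OF r])
    then have "elems M ! i = encode_list (map (\<lambda>j. encode_bool (edge M i j)) [0..<len M])"
      by (metis encode_list_elems)
    then show "elems M ! i
        = map (\<lambda>i. encode_list (map (\<lambda>j. encode_bool (edge M i j)) [0..<len M])) [0..<len M] ! i"
      using i by simp
  qed simp
  then show "M = matrix (len M) (edge M)"
    unfolding matrix_def by (metis encode_list_elems)
next
  assume M: "M = matrix (len M) (edge M)"
  have "left (encode_bool b) = Leaf \<and> right (encode_bool b) = Leaf" for b by (cases b) auto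
  then have "holds mat_t (Node (matrix n R) z)" for n R
    by (auto simp: mat_t_def matrix_def)
  from this[of "len M" "edge M"] show "holds mat_t (Node M z)" unfolding M[symmetric] .
qed

lemma holds_sym_t:
  "holds sym_t (Node M z) \<longleftrightarrow> (\<forall>i<len M. \<forall>j<len M. edge M i j \<longrightarrow> edge M j i)"
  by (auto simp: sym_t_def)

lemma holds_loopfree_t: "holds loopfree_t (Node M z) \<longleftrightarrow> (\<forall>i<len M. \<not> edge M i i)"
  by (auto simp: loopfree_t_def)

lemma encode_graph_matrix: "encode_graph G = matrix (card (pverts G)) (\<lambda>i j. (i, j) \<in> parcs G)"
  by (simp add: encode_graph_def matrix_def Let_def)

lemma edge_encode_graph:
  assumes "pair_wf_digraph G" "pverts G = {..<n}"
  shows "edge (encode_graph G) i j \<longleftrightarrow> (i, j) \<in> parcs G" "len (encode_graph G) = n"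
  using pair_wf_digraph.in_arcsD1[OF assms(1), of i j] pair_wf_digraph.in_arcsD2[OF assms(1), of i j] assms(2)
  by (auto simp: encode_graph_matrix edge_matrix)

lemma encode_graph_eq_matrix:
  assumes "pair_wf_digraph G" "pverts G = {..<n}"
  shows "encode_graph G = matrix (len (encode_graph G)) (edge (encode_graph G))"
proof -
  have "edge (encode_graph G) = (\<lambda>i j. (i, j) \<in> parcs G)"
    by (intro ext edge_encode_graph(1)[OF assms])
  then show ?thesis by (simp add: encode_graph_matrix)
qed

definition decode_graph :: "data \<Rightarrow> nat pair_pre_digraph" where
  "decode_graph M = \<lparr> pverts = {..<len M}, parcs = {(i, j). edge M i j} \<rparr>"

lemma encode_decode_graph: "M = matrix (len M) (edge M) \<Longrightarrow> encode_graph (decode_graph M) = M"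
  by (simp add: encode_graph_matrix decode_graph_def)

lemma edge_less: "M = matrix (len M) (edge M) \<Longrightarrow> edge M i j \<Longrightarrow> i < len M \<and> j < len M"
  by (metis edge_matrix)

lemma pair_pseudo_graph_decode:
  assumes "M = matrix (len M) (edge M)" "\<forall>i<len M. \<forall>j<len M. edge M i j \<longrightarrow> edge M j i"
  shows "pair_pseudo_graph (decode_graph M)"
proof
  have "parcs (decode_graph M) \<subseteq> {..<len M} \<times> {..<len M}"
    using edge_less[OF assms(1)] by (auto simp: decode_graph_def)
  then show "finite (parcs (decode_graph M))" by (rule finite_subset) simp
  have "edge M j i" if "edge M i j" for i j
    using edge_less[OF assms(1) that] assms(2) that by blast
  then have "sym (parcs (decode_graph M))"
    unfolding decode_graph_def by (auto intro!: symI)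
  then show "symmetric (decode_graph M)" by (simp add: symmetric_def)
qed (use edge_less[OF assms(1)] in \<open>auto simp: decode_graph_def\<close>)

lemma pair_graph_decode:
  assumes "M = matrix (len M) (edge M)" "\<forall>i<len M. \<forall>j<len M. edge M i j \<longrightarrow> edge M j i"
    "\<forall>i<len M. \<not> edge M i i"
  shows "pair_graph (decode_graph M)"
proof -
  interpret pair_pseudo_graph "decode_graph M" by (rule pair_pseudo_graph_decode[OF assms(1,2)])
  show ?thesis
    by unfold_locales (use edge_less[OF assms(1)] assms(3) in \<open>fastforce simp: decode_graph_def\<close>)
qed

lemma check_tD:
  assumes "holds check_t (Node g (Node h z))"
  shows "checked g h" "(decode_graph g, decode_graph h) \<in> instances"
    "encode_instance (decode_graph g, decode_graph h) = Node g h"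
proof -
  have c: "g = matrix (len g) (edge g)" "\<forall>i<len g. \<forall>j<len g. edge g i j \<longrightarrow> edge g j i"
     "\<forall>i<len g. \<not> edge g i i"
     "h = matrix (len h) (edge h)" "\<forall>i<len h. \<forall>j<len h. edge h i j \<longrightarrow> edge h j i"
    using assms by (simp_all add: check_t_def holds_mat_t holds_sym_t holds_loopfree_t)
  show "checked g h"
    by unfold_locales (use c(2,3,5) edge_less[OF c(1)] edge_less[OF c(4)] in blast)+
  show "(decode_graph g, decode_graph h) \<in> instances"
    unfolding instances_def using pair_graph_decode[OF c(1-3)] pair_pseudo_graph_decode[OF c(4,5)]
    by (auto simp: decode_graph_def)
  show "encode_instance (decode_graph g, decode_graph h) = Node g h"
    using encode_decode_graph c(1,4) by simp
qed

lemma holds_check_t: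
  "holds check_t (Node g (Node h z)) \<longleftrightarrow> Node g h \<in> encode_instance ` instances"
proof
  assume "holds check_t (Node g (Node h z))"
  from check_tD(2,3)[OF this] show "Node g h \<in> encode_instance ` instances" by force
next
  assume "Node g h \<in> encode_instance ` instances"
  then obtain G H n m where GH: "pair_graph G" "pair_pseudo_graph H" "pverts G = {..<n}" "pverts H = {..<m}"
    "g = encode_graph G" "h = encode_graph H"
    by (auto simp: instances_def)
  interpret G: pair_graph G by fact
  interpret H: pair_pseudo_graph H by fact
  have wf: "pair_wf_digraph G" "pair_wf_digraph H" by unfold_locales
  note eG = edge_encode_graph[OF wf(1) GH(3)] and eH = edge_encode_graph[OF wf(2) GH(4)]
  have "holds mat_t (Node g z)" "holds mat_t (Node h z)" for z
    unfolding holds_mat_t GH using encode_graph_eq_matrix wf GH(3,4) by blast+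
  moreover have "sym (parcs G)" "sym (parcs H)"
    using G.sym_arcs H.sym_arcs by (simp_all add: symmetric_def)
  ultimately show "holds check_t (Node g (Node h z))"
    using eG eH G.no_loops'
    by (fastforce simp: check_t_def holds_sym_t holds_loopfree_t GH(5,6) dest: symD)
qed

section \<open>Running time\<close>

lemma locally_injective_hom_decode:
  "locally_injective_hom f (decode_graph g) (decode_graph h) \<longleftrightarrow> li_hom (len g) (len h) (edge g) (edge h) f"
  by (auto simp: locally_injective_hom_def graph_hom_def li_hom_def decode_graph_def neighborhood_def)

lemma mem_LIHom_iff:
  assumes "holds check_t (Node g (Node h z))"
  shows "Node g h \<in> LIHom \<longleftrightarrow> li_exists g h"
proof -
  have "Node g h \<in> LIHom \<longleftrightarrow> (decode_graph g, decode_graph h) \<in>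
      {(G, H) \<in> instances. \<exists>f. locally_injective_hom f G H}"
    unfolding LIHom_def check_tD(3)[OF assms, symmetric]
    by (rule inj_on_image_mem_iff[OF inj_on_encode_instance check_tD(2)[OF assms]]) auto
  then show ?thesis
    using check_tD(2)[OF assms] by (simp add: locally_injective_hom_decode li_exists_def)
qed

lemma LIHom_subset: "LIHom \<subseteq> encode_instance ` instances"
  unfolding LIHom_def by auto

lemma holds_main_t: "holds main_t x \<longleftrightarrow> x \<in> LIHom"
proof (cases x)
  case Leaf
  then show ?thesis using LIHom_subset by (auto simp: main_t_def)
next
  case (Node g h)
  have "holds main_t x \<longleftrightarrow> holds check_t (Node g (Node h Leaf)) \<and> holds solve_t (Node g (Node h Leaf))"
    by (simp add: main_t_def Node)
  also have "\<dots> \<longleftrightarrow> x \<in> LIHom"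
  proof (cases "holds check_t (Node g (Node h Leaf))")
    case True
    interpret checked g h by (rule check_tD(1)[OF True])
    show ?thesis using mem_LIHom_iff[OF True] holds_solve_t True Node by simp
  next
    case False
    then show ?thesis using LIHom_subset holds_check_t Node by blast
  qed
  finally show ?thesis .
qed

lemma vertex_cover_decode:
  "vertex_cover (decode_graph g) C \<longleftrightarrow>
     C \<subseteq> {..<len g} \<and> (\<forall>u v. edge g u v \<and> u < len g \<and> v < len g \<longrightarrow> u \<in> C \<or> v \<in> C)"
  by (auto simp: vertex_cover_def decode_graph_def)

lemma guest_vertex_cover_number_decode:
  assumes "holds check_t (Node g (Node h z))"
  shows "guest_vertex_cover_number (Node g h) = vertex_cover_number (decode_graph g)"
proof -
  have "inv_into instances encode_instance (Node g h) = (decode_graph g, decode_graph h)"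
    using inv_into_f_f[OF inj_on_encode_instance check_tD(2)[OF assms]] check_tD(3)[OF assms] by simp
  then show ?thesis
    using assms holds_check_t by (simp add: guest_vertex_cover_number_def)
qed

text \<open>The invariant \<open>cover_inv\<close> is applied with an optimal cover as
  \<open>C\<close>, although the algorithm never sees one.\<close>

lemma (in checked) length_cover_le: "length cover \<le> 2 * vertex_cover_number (decode_graph G)"
proof -
  have "vertex_cover (decode_graph G) {..<len G}" by (auto simp: vertex_cover_decode)
  then have "\<exists>k C. vertex_cover (decode_graph G) C \<and> card C = k" by blast
  from LeastI_ex[OF this] obtain C where
    C: "vertex_cover (decode_graph G) C" "card C = vertex_cover_number (decode_graph G)"
    unfolding vertex_cover_number_def by blast
  have "finite C" using C(1) by (auto simp: vertex_cover_decode intro: finite_subset)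
  have "length cover \<le> 2 * card (C \<inter> set cover)"
    using cover_inv[of C] C(1) G_less G_sym unfolding cover_inv_def vertex_cover_decode by blast
  also have "\<dots> \<le> 2 * card C" using \<open>finite C\<close> by (simp add: card_mono)
  finally show ?thesis using C(2) by simp
qed

lemma len_less_data_size: "len d < data_size d"
  by (induction d) auto

lemma elems_data_size: "x \<in> set (elems d) \<Longrightarrow> data_size x < data_size d"
  by (induction d) auto

lemma bounded_check_t:
  assumes "data_size g + data_size h < N"
  shows "bounded N check_t (Node g (Node h z))"
proof -
  have mat: "bounded N mat_t (Node M z)" if "data_size M < N" for M z
  proof -
    have "len r \<le> N" if "r \<in> set (elems M)" for r
      using elems_data_size[OF that] len_less_data_size[of r] \<open>data_size M < N\<close> by linarith
    then show ?thesis using that len_less_data_size[of M] by (auto simp: mat_t_def)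
  qed
  have sym: "bounded N sym_t (Node M z)" "bounded N loopfree_t (Node M z)" if "data_size M < N" for M z
    using that len_less_data_size[of M] by (auto simp: sym_t_def loopfree_t_def)
  show ?thesis using assms by (simp add: check_t_def mat sym)
qed

text \<open>Both bases, \<open>len H\<close> and \<open>Suc (len G)\<close>, are at most
  \<open>data_size x\<close>. The exponents are the size of the cover, at most 2 * k \<le> 4 ^ k,
  and the number of classes, at most 2 ^ (2 * k) = 4 ^ k. Validation fits into
  \<open>data_size x\<close> itself, which is all that remains when the parameter is 0.\<close>

lemma bounded_main_t:
  assumes N: "N = data_size x ^ 4 ^ guest_vertex_cover_number x"
  shows "bounded N main_t x"
proof (cases x)
  case Leaf
  then show ?thesis by (simp add: main_t_def)
next
  case (Node g h)
  have x: "1 \<le> data_size x" by (simp add: Node)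
  have "data_size x ^ 1 \<le> N" unfolding N by (rule power_increasing) (use x in auto)
  then have size: "data_size g + data_size h < N" by (simp add: Node)
  have "bounded N solve_t (Node g (Node h Leaf))" if c: "holds check_t (Node g (Node h Leaf))"
  proof -
    interpret checked g h by (rule check_tD(1)[OF c])
    let ?k = "vertex_cover_number (decode_graph g)"
    have N: "N = data_size x ^ 4 ^ ?k"
      unfolding N Node guest_vertex_cover_number_decode[OF c] ..
    have pow: "b ^ e \<le> N" if "b \<le> data_size x" "e \<le> 4 ^ ?k" for b e
      unfolding N using that x by (meson power_increasing power_mono le0 le_trans)
    have "2 * k \<le> 4 ^ k" for k :: nat
      using less_exp[of "2 * k"] by (simp add: power_mult)
    then have cover: "length cover \<le> 4 ^ ?k" using length_cover_le le_trans by blast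
    have "length reps \<le> 2 ^ card (set cover)"
      by (rule reps_inv_length[OF reps_inv]) simp
    also have "\<dots> \<le> 2 ^ (2 * ?k)"
      using length_cover_le card_length[of cover] by (intro power_increasing) auto
    also have "\<dots> = 4 ^ ?k" by (simp add: power_mult)
    finally have reps: "length reps \<le> 4 ^ ?k" .
    have "len g < data_size x" "len h < data_size x"
      using len_less_data_size[of g] len_less_data_size[of h] by (simp_all add: Node)
    then show ?thesis
      using size len_less_data_size[of g] len_less_data_size[of h] cover reps
      by (intro bounded_solve_t pow) auto
  qed
  moreover have "bounded N check_t (Node g (Node h Leaf))" by (rule bounded_check_t[OF size])
  ultimately show ?thesis by (simp add: main_t_def Node)
qed

section \<open>Termination, and computability of the XP bounds\<close>

lemma bounded_mono: "bounded N t e \<Longrightarrow> N \<le> N' \<Longrightarrow> bounded N' t e"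
proof (induction t arbitrary: e)
  case (TFold l i b)
  then show ?case by (simp only: bounded.simps) (meson le_trans)
qed (auto split: if_splits)

text \<open>Every program of the fold language halts. Functions witnessing membership in XP only
  have to be computable, so no explicit bound is needed for them.\<close>

lemma ex_bounded: "\<exists>N\<ge>1. bounded N t e"
proof (induction t arbitrary: e)
  case (TFold l i b)
  let ?xs = "elems (eval l e)"
  let ?e = "\<lambda>k. Node (?xs ! k) (Node (foldl (\<lambda>acc x. eval b (Node x (Node acc e))) (eval i e) (take k ?xs)) e)"
  have "\<forall>k. \<exists>N. bounded N b (?e k)" using TFold.IH(3) by blast
  from choice[OF this] obtain M where M: "\<And>k. bounded (M k) b (?e k)" by blast
  obtain N1 N2 where N: "bounded N1 l e" "bounded N2 i e" "1 \<le> N1"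
    using TFold.IH(1,2) by blast
  \<comment> \<open>Each round has its own bound \<open>M k\<close>; their sum dominates all of
    them.\<close>
  let ?N = "N1 + N2 + len (eval l e) + (\<Sum>k<len (eval l e). M k)"
  have "bounded ?N b (?e k)" if "k < len (eval l e)" for k
    by (rule bounded_mono[OF M]) (use that member_le_sum[of k "{..<len (eval l e)}" M] in simp)
  then have "bounded ?N (TFold l i b) e"
    using bounded_mono[OF N(1), of ?N] bounded_mono[OF N(2), of ?N] by simp
  then show ?case using N(3) by (intro exI[of _ ?N]) simp
next
  case (TIf c a b)
  obtain N1 N2 N3 where "bounded N1 c e" "bounded N2 a e" "bounded N3 b e" "1 \<le> N1"
    using TIf.IH by blast
  then show ?case
    by (intro exI[of _ "N1 + N2 + N3"]) (auto elim: bounded_mono)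
next
  case (TComp b a)
  obtain N1 N2 where "bounded N1 a e" "bounded N2 b (eval a e)" "1 \<le> N1"
    using TComp.IH by blast
  then show ?case
    by (intro exI[of _ "N1 + N2"]) (auto elim: bounded_mono)
next
  case (TNode a b)
  obtain N1 N2 where "bounded N1 a e" "bounded N2 b e" "1 \<le> N1"
    using TNode.IH by blast
  then show ?case
    by (intro exI[of _ "N1 + N2"]) (auto elim: bounded_mono)
qed auto

text \<open>The leading assignment copies the input to variable 1, where compiled code expects its
  environment.\<close>

lemma compile_run:
  "\<exists>K D. \<forall>N\<ge>1. \<forall>x. bounded N t x \<longrightarrow>
     (\<exists>u s. exec (Seq (Assign 1 (EVar 0)) (compile t)) (input x) u s \<and> u \<le> K * N ^ D \<and> s 0 = eval t x)"
proof -
  obtain K D where KD: "\<And>N s. 1 \<le> N \<Longrightarrow> bounded N t (s 1) \<Longrightarrow>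
      exec_le (compile t) s (K * N ^ D) (s(0 := eval t (s 1)))"
    using compile_correct[of t] by blast
  have "\<exists>u s. exec (Seq (Assign 1 (EVar 0)) (compile t)) (input x) u s \<and> u \<le> (K + 2) * N ^ D \<and> s 0 = eval t x"
    if N: "1 \<le> N" and "bounded N t x" for N x
  proof -
    let ?s = "(input x)(1 := x)"
    have "exec_le (Assign 1 (EVar 0)) (input x) 2 ?s"
      by (rule exec_le_mono[OF exec_le_Assign]) (simp_all add: input_def)
    moreover have "exec_le (compile t) ?s (K * N ^ D) (?s(0 := eval t x))"
      using KD[of N ?s] that by simp
    ultimately have "exec_le (Seq (Assign 1 (EVar 0)) (compile t)) (input x) (2 + K * N ^ D) (?s(0 := eval t x))"
      by (rule exec_le_Seq)
    moreover have "2 + K * N ^ D \<le> (K + 2) * N ^ D"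
      using le_poly[OF N, of 2 D] by (simp add: algebra_simps)
    ultimately show ?thesis
      unfolding exec_le_def by (metis fun_upd_same le_trans)
  qed
  then show ?thesis by blast
qed

lemma computableI:
  assumes "\<And>n. eval t (encode_nat n) = encode_nat (f n)"
  shows "computable f"
proof -
  obtain K D where KD: "\<And>N x. 1 \<le> N \<Longrightarrow> bounded N t x \<Longrightarrow>
     \<exists>u s. exec (Seq (Assign 1 (EVar 0)) (compile t)) (input x) u s \<and> u \<le> K * N ^ D \<and> s 0 = eval t x"
    using compile_run[of t] by blast
  have "\<exists>u s. exec (Seq (Assign 1 (EVar 0)) (compile t)) (input (encode_nat n)) u s \<and> s 0 = encode_nat (f n)" for n
    using ex_bounded[of t "encode_nat n"] KD assms by metis
  then show ?thesis unfolding computable_def by blast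
qed

primrec const_t :: "nat \<Rightarrow> tm" where
  "const_t 0 = TLeaf"
| "const_t (Suc n) = TNode TLeaf (const_t n)"

lemma eval_const_t [simp]: "eval (const_t n) e = encode_nat n"
  by (induction n) auto

definition add_t :: "tm \<Rightarrow> tm \<Rightarrow> tm" where
  "add_t a b = TFold a b (TNode TLeaf (var 1))"

lemma foldl_Node_Leaf:
  "foldl (\<lambda>acc x. Node Leaf acc) (encode_nat k) xs = encode_nat (length xs + k)" for xs :: "data list"
  by (induction xs rule: rev_induct) auto

lemma eval_add_t:
  "eval a e = encode_nat i \<Longrightarrow> eval b e = encode_nat j \<Longrightarrow> eval (add_t a b) e = encode_nat (i + j)"
  by (simp add: add_t_def foldl_Node_Leaf)

lemma computable_const: "computable (\<lambda>_. K)"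
  by (rule computableI[of "const_t K"]) simp

lemma computable_mult_power4: "computable (\<lambda>k. D * 4 ^ k)"
proof (rule computableI)
  \<comment> \<open>Two doublings quadruple the accumulator, and the fold over the unary
    \<open>k\<close> starts from \<open>D\<close>.\<close>
  let ?step = "add_t (add_t (var 1) (var 1)) (add_t (var 1) (var 1))"
  have step: "eval ?step (Node x (Node (encode_nat i) e)) = encode_nat (4 * i)" for x i e
  proof -
    have "eval (add_t (var 1) (var 1)) (Node x (Node (encode_nat i) e)) = encode_nat (i + i)"
      by (rule eval_add_t) simp_all
    moreover have "i + i + (i + i) = 4 * i" by simp
    ultimately show ?thesis using eval_add_t by metis
  qed
  have "foldl (\<lambda>acc x. eval ?step (Node x (Node acc e))) (encode_nat D) xs = encode_nat (D * 4 ^ length xs)"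
    for xs e
    by (induction xs rule: rev_induct) (simp_all add: step[unfolded One_nat_def] mult.left_commute)
  then show "eval (TFold TEnv (const_t D) ?step) (encode_nat k) = encode_nat (D * 4 ^ k)" for k
    by simp
qed

theorem theorem21:
  shows "in_XP LIHom guest_vertex_cover_number"
proof -
  obtain K D where KD: "\<And>N x. 1 \<le> N \<Longrightarrow> bounded N main_t x \<Longrightarrow>
     \<exists>u s. exec (Seq (Assign 1 (EVar 0)) (compile main_t)) (input x) u s \<and> u \<le> K * N ^ D \<and> s 0 = eval main_t x"
    using compile_run[of main_t] by blast
  have "\<exists>u s. exec (Seq (Assign 1 (EVar 0)) (compile main_t)) (input x) u s \<and>
      u \<le> K * data_size x ^ (D * 4 ^ guest_vertex_cover_number x) \<and> (s 0 \<noteq> Leaf \<longleftrightarrow> x \<in> LIHom)" for x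
  proof -
    \<comment> \<open>Raising this to the degree \<open>D\<close> of the program multiplies the
      exponent, giving \<open>D * 4 ^ k\<close>, while the coefficient stays the constant
      \<open>K\<close>.\<close>
    let ?N = "data_size x ^ 4 ^ guest_vertex_cover_number x"
    have "1 \<le> data_size x" by (cases x) auto
    then have "1 \<le> ?N" by simp
    from KD[OF this bounded_main_t[OF refl]] obtain u s where
      "exec (Seq (Assign 1 (EVar 0)) (compile main_t)) (input x) u s" "u \<le> K * ?N ^ D" "s 0 = eval main_t x"
      by blast
    then show ?thesis
      unfolding holds_main_t[symmetric] holds_def power_mult[symmetric] by (metis mult.commute)
  qed
  then show ?thesis
    unfolding in_XP_def
    by (intro exI[of _ "Seq (Assign 1 (EVar 0)) (compile main_t)"] exI[of _ "\<lambda>_. K"]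
        exI[of _ "\<lambda>k. D * 4 ^ k"]) (simp add: computable_const computable_mult_power4)
qed

end
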